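(* Let $p,q$ be primes. Every nilpotent loop of order $pq$ has a finite equational basis.
   Context: A loop is an algebra $(A,\cdot,\backslash,/,1)$ satisfying $x\backslash(xy)=y$, $x(x\backslash y)=y$, $(yx)/x=y$, $(y/x)x=y$, $x\cdot 1=1\cdot x=x$; equivalently a groupoid $(A,\cdot)$ with identity $1$ such that for all $a,b\in A$ the equations $ax=b$ and $ya=b$ have unique solutions. An algebra has a finite equational basis if there is a finite set of identities, all true in the algebra, from which every identity true in the algebra follows (in equational logic). For congruences $\alpha,\beta$ of an algebra $\mathbf{A}$, the (term condition) commutator $[\alpha,\beta]$ is the smallest congruence $\delta$ such that for all polynomial operations $f$ of $\mathbf{A}$ (compositions of basic operations, projections and constants), with variables split into two blocks, and all tuples $a,b$ coordinatewise congruent modulo $\alpha$ and $c,d$ coordinatewise congruent modulo $\beta$: $f(a,c)\equiv_\delta f(a,d)$ implies $f(b,c)\equiv_\delta f(b,d)$. $\mathbf{A}$ is nilpotent if for some $k\ge 1$ there are congruences $1_A=\alpha_0\ge\alpha_1\ge\dots\ge\alpha_k=0_A$ with $[\alpha_i,1_A]\le\alpha_{i+1}$ for all $i<k$, where $1_A$ is the total congruence and $0_A$ is equality. (For loops this is the same as central nilpotence in the sense of Bruck.) *)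

theory Defs
  imports "HOL-Algebra.Coset" "HOL-Computational_Algebra.Primes"
begin

text \<open>\<open>ldiv L x y\<close> is the left quotient of \<open>y\<close> by \<open>x\<close> (the solution \<open>z\<close> of \<open>x z = y\<close>), and
  \<open>rdiv L y x\<close> is the right quotient \<open>y / x\<close> (the solution \<open>z\<close> of \<open>z x = y\<close>).\<close>

record 'a loop = "'a monoid" +
  ldiv :: "'a \<Rightarrow> 'a \<Rightarrow> 'a"
  rdiv :: "'a \<Rightarrow> 'a \<Rightarrow> 'a"

locale loop =
  fixes L :: "('a, 'm) loop_scheme" (structure)
  assumes m_closed: "\<lbrakk>x \<in> carrier L; y \<in> carrier L\<rbrakk> \<Longrightarrow> x \<otimes> y \<in> carrier L"
    and ldiv_closed: "\<lbrakk>x \<in> carrier L; y \<in> carrier L\<rbrakk> \<Longrightarrow> ldiv L x y \<in> carrier L"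
    and rdiv_closed: "\<lbrakk>x \<in> carrier L; y \<in> carrier L\<rbrakk> \<Longrightarrow> rdiv L x y \<in> carrier L"
    and one_closed: "\<one> \<in> carrier L"
    and ldiv_mult: "\<lbrakk>x \<in> carrier L; y \<in> carrier L\<rbrakk> \<Longrightarrow> ldiv L x (x \<otimes> y) = y"
    and mult_ldiv: "\<lbrakk>x \<in> carrier L; y \<in> carrier L\<rbrakk> \<Longrightarrow> x \<otimes> ldiv L x y = y"
    and rdiv_mult: "\<lbrakk>x \<in> carrier L; y \<in> carrier L\<rbrakk> \<Longrightarrow> rdiv L (y \<otimes> x) x = y"
    and mult_rdiv: "\<lbrakk>x \<in> carrier L; y \<in> carrier L\<rbrakk> \<Longrightarrow> rdiv L y x \<otimes> x = y"
    and r_one: "x \<in> carrier L \<Longrightarrow> x \<otimes> \<one> = x"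
    and l_one: "x \<in> carrier L \<Longrightarrow> \<one> \<otimes> x = x"

datatype 'v lterm =
    Var 'v
  | One
  | Mult "'v lterm" "'v lterm"
  | LDiv "'v lterm" "'v lterm"
  | RDiv "'v lterm" "'v lterm"

primrec eval_lterm :: "('a, 'm) loop_scheme \<Rightarrow> ('v \<Rightarrow> 'a) \<Rightarrow> 'v lterm \<Rightarrow> 'a" where
  "eval_lterm L e (Var v) = e v"
| "eval_lterm L e One = \<one>\<^bsub>L\<^esub>"
| "eval_lterm L e (Mult s t) = eval_lterm L e s \<otimes>\<^bsub>L\<^esub> eval_lterm L e t"
| "eval_lterm L e (LDiv s t) = ldiv L (eval_lterm L e s) (eval_lterm L e t)"
| "eval_lterm L e (RDiv s t) = rdiv L (eval_lterm L e s) (eval_lterm L e t)"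

primrec subst_lterm :: "('v \<Rightarrow> 'w lterm) \<Rightarrow> 'v lterm \<Rightarrow> 'w lterm" where
  "subst_lterm \<sigma> (Var v) = \<sigma> v"
| "subst_lterm \<sigma> One = One"
| "subst_lterm \<sigma> (Mult s t) = Mult (subst_lterm \<sigma> s) (subst_lterm \<sigma> t)"
| "subst_lterm \<sigma> (LDiv s t) = LDiv (subst_lterm \<sigma> s) (subst_lterm \<sigma> t)"
| "subst_lterm \<sigma> (RDiv s t) = RDiv (subst_lterm \<sigma> s) (subst_lterm \<sigma> t)"

type_synonym identity = "nat lterm \<times> nat lterm"

definition holds_in :: "('a, 'm) loop_scheme \<Rightarrow> identity \<Rightarrow> bool" where
  "holds_in L = (\<lambda>(s, t). \<forall>e. (\<forall>i. e i \<in> carrier L) \<longrightarrow> eval_lterm L e s = eval_lterm L e t)"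

inductive eq_derivable :: "identity set \<Rightarrow> nat lterm \<Rightarrow> nat lterm \<Rightarrow> bool" for B where
  inst: "(s, t) \<in> B \<Longrightarrow> eq_derivable B (subst_lterm \<sigma> s) (subst_lterm \<sigma> t)"
| refl: "eq_derivable B t t"
| sym: "eq_derivable B s t \<Longrightarrow> eq_derivable B t s"
| trans: "\<lbrakk>eq_derivable B s t; eq_derivable B t u\<rbrakk> \<Longrightarrow> eq_derivable B s u"
| mult: "\<lbrakk>eq_derivable B s s'; eq_derivable B t t'\<rbrakk> \<Longrightarrow> eq_derivable B (Mult s t) (Mult s' t')"
| ldiv: "\<lbrakk>eq_derivable B s s'; eq_derivable B t t'\<rbrakk> \<Longrightarrow> eq_derivable B (LDiv s t) (LDiv s' t')"
| rdiv: "\<lbrakk>eq_derivable B s s'; eq_derivable B t t'\<rbrakk> \<Longrightarrow> eq_derivable B (RDiv s t) (RDiv s' t')"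

definition has_finite_equational_basis :: "('a, 'm) loop_scheme \<Rightarrow> bool" where
  "has_finite_equational_basis L \<longleftrightarrow>
     (\<exists>B. finite B \<and> (\<forall>\<epsilon>\<in>B. holds_in L \<epsilon>) \<and>
          (\<forall>s t. holds_in L (s, t) \<longrightarrow> eq_derivable B s t))"

definition loop_congruence :: "('a, 'm) loop_scheme \<Rightarrow> 'a rel \<Rightarrow> bool" where
  "loop_congruence L \<theta> \<longleftrightarrow>
     equiv (carrier L) \<theta> \<and>
     (\<forall>x x' y y'. (x, x') \<in> \<theta> \<longrightarrow> (y, y') \<in> \<theta> \<longrightarrow>
        (x \<otimes>\<^bsub>L\<^esub> y, x' \<otimes>\<^bsub>L\<^esub> y') \<in> \<theta> \<and>
        (ldiv L x y, ldiv L x' y') \<in> \<theta> \<and>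
        (rdiv L x y, rdiv L x' y') \<in> \<theta>)"

abbreviation total_congruence :: "('a, 'm) loop_scheme \<Rightarrow> 'a rel" where
  "total_congruence L \<equiv> carrier L \<times> carrier L"

abbreviation zero_congruence :: "('a, 'm) loop_scheme \<Rightarrow> 'a rel" where
  "zero_congruence L \<equiv> Id_on (carrier L)"

text \<open>A polynomial operation is given by a term whose leaves are variables of the first block
  (\<open>PX\<close>), variables of the second block (\<open>PY\<close>) or constants from the carrier. Tuples are
  represented by sequences; a term uses only finitely many of their entries.\<close>

datatype 'a pleaf = PX nat | PY nat | PConst 'a

type_synonym 'a loop_poly = "'a pleaf lterm"

definition loop_polys :: "('a, 'm) loop_scheme \<Rightarrow> 'a loop_poly set" where
  "loop_polys L = {f. \<forall>k. PConst k \<in> set_lterm f \<longrightarrow> k \<in> carrier L}"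

definition eval_poly ::
    "('a, 'm) loop_scheme \<Rightarrow> 'a loop_poly \<Rightarrow> (nat \<Rightarrow> 'a) \<Rightarrow> (nat \<Rightarrow> 'a) \<Rightarrow> 'a" where
  "eval_poly L f x y =
     eval_lterm L (\<lambda>v. case v of PX i \<Rightarrow> x i | PY i \<Rightarrow> y i | PConst k \<Rightarrow> k) f"

definition term_condition ::
    "('a, 'm) loop_scheme \<Rightarrow> 'a rel \<Rightarrow> 'a rel \<Rightarrow> 'a rel \<Rightarrow> bool" where
  "term_condition L \<alpha> \<beta> \<delta> \<longleftrightarrow>
     (\<forall>f\<in>loop_polys L. \<forall>a b c d.
        (\<forall>i. (a i, b i) \<in> \<alpha>) \<longrightarrow> (\<forall>i. (c i, d i) \<in> \<beta>) \<longrightarrow>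
        (eval_poly L f a c, eval_poly L f a d) \<in> \<delta> \<longrightarrow>
        (eval_poly L f b c, eval_poly L f b d) \<in> \<delta>)"

text \<open>The intersection below is itself a congruence satisfying the term condition, hence the
  smallest one; see \<open>commutator_least\<close>.\<close>

definition commutator :: "('a, 'm) loop_scheme \<Rightarrow> 'a rel \<Rightarrow> 'a rel \<Rightarrow> 'a rel" where
  "commutator L \<alpha> \<beta> = \<Inter> {\<delta>. loop_congruence L \<delta> \<and> term_condition L \<alpha> \<beta> \<delta>}"

definition nilpotent_loop :: "('a, 'm) loop_scheme \<Rightarrow> bool" where
  "nilpotent_loop L \<longleftrightarrow>
     (\<exists>k \<alpha>. 1 \<le> k \<and>
        (\<forall>i\<le>k. loop_congruence L (\<alpha> i)) \<and>
        \<alpha> 0 = total_congruence L \<and> \<alpha> k = zero_congruence L \<and>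
        (\<forall>i<k. \<alpha> (Suc i) \<subseteq> \<alpha> i) \<and>
        (\<forall>i<k. commutator L (\<alpha> i) (total_congruence L) \<subseteq> \<alpha> (Suc i)))"

lemma (in loop) eval_lterm_closed:
  assumes "\<And>v. v \<in> set_lterm t \<Longrightarrow> e v \<in> carrier L"
  shows "eval_lterm L e t \<in> carrier L"
  using assms by (induction t) (auto intro: m_closed ldiv_closed rdiv_closed one_closed)

lemma (in loop) eval_poly_closed:
  assumes "f \<in> loop_polys L" "\<And>i. x i \<in> carrier L" "\<And>i. y i \<in> carrier L"
  shows "eval_poly L f x y \<in> carrier L"
  unfolding eval_poly_def
  by (rule eval_lterm_closed) (use assms in \<open>auto simp: loop_polys_def split: pleaf.split\<close>)

lemma (in loop) loop_congruence_total: "loop_congruence L (total_congruence L)"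
  by (auto simp: loop_congruence_def equiv_def refl_on_def sym_def trans_def
      intro: m_closed ldiv_closed rdiv_closed)

lemma (in loop) term_condition_total:
  assumes "loop_congruence L \<alpha>" "loop_congruence L \<beta>"
  shows "term_condition L \<alpha> \<beta> (total_congruence L)"
proof -
  have "\<alpha> \<subseteq> carrier L \<times> carrier L" "\<beta> \<subseteq> carrier L \<times> carrier L"
    using assms by (auto simp: loop_congruence_def equiv_def refl_on_def)
  then show ?thesis
    unfolding term_condition_def by (blast intro: eval_poly_closed)
qed

lemma (in loop) commutator_least:
  assumes "loop_congruence L \<alpha>" "loop_congruence L \<beta>"
  shows "loop_congruence L (commutator L \<alpha> \<beta>)"
    and "term_condition L \<alpha> \<beta> (commutator L \<alpha> \<beta>)"
    and "\<And>\<delta>. \<lbrakk>loop_congruence L \<delta>; term_condition L \<alpha> \<beta> \<delta>\<rbrakk> \<Longrightarrow> commutator L \<alpha> \<beta> \<subseteq> \<delta>"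
proof -
  let ?D = "{\<delta>. loop_congruence L \<delta> \<and> term_condition L \<alpha> \<beta> \<delta>}"
  have ne: "total_congruence L \<in> ?D"
    using loop_congruence_total term_condition_total[OF assms] by simp
  have "equiv (carrier L) (\<Inter> ?D)"
  proof (rule equivI)
    show "\<Inter> ?D \<subseteq> carrier L \<times> carrier L" using ne by blast
    show "refl_on (carrier L) (\<Inter> ?D)"
      by (auto simp: loop_congruence_def equiv_def refl_on_def)
    show "sym (\<Inter> ?D)"
      by (rule symI) (auto simp: loop_congruence_def equiv_def dest: symD)
    show "trans (\<Inter> ?D)"
      by (rule transI) (auto simp: loop_congruence_def equiv_def dest: transD)
  qed
  then show "loop_congruence L (commutator L \<alpha> \<beta>)"
    by (auto simp: loop_congruence_def commutator_def)
  show "term_condition L \<alpha> \<beta> (commutator L \<alpha> \<beta>)"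
    unfolding term_condition_def commutator_def by blast
  show "commutator L \<alpha> \<beta> \<subseteq> \<delta>" if "loop_congruence L \<delta>" "term_condition L \<alpha> \<beta> \<delta>" for \<delta>
    using that by (auto simp: commutator_def)
qed

end

theory Submission
  imports Defs "HOL-Algebra.Multiplicative_Group" "HOL-Number_Theory.Cong"
begin

text \<open>
  A nilpotent loop \<open>L\<close> of order \<open>pq\<close> is an abelian group or an extension of its center, of prime
  order \<open>r\<close>, by a group of prime order \<open>s\<close>. For a finite algebra the identities in at most \<open>N\<close>
  variables always have a finite basis (\<open>finitely_many_variables_basis\<close>). So it is enough to find
  an \<open>N\<close> such that every loop \<open>M\<close> satisfying the \<open>N\<close>-variable identities of \<open>L\<close> satisfies all
  identities of \<open>L\<close>; the theorem follows when \<open>M\<close> is the free algebra defined by a finite basis of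
  the \<open>N\<close>-variable identities.

  Such an \<open>N\<close> comes from a reduction of the number of variables. Split the variables of a term \<open>t\<close>
  into a block \<open>y\<close> of \<open>m\<close> variables and the remaining variables \<open>x\<close>, and call
  \<open>t(x,y) / (t(x,1) t(1,y))\<close> its mixed part. For \<open>t = f(u,v)\<close> with a basic operation \<open>f\<close>, the mixed
  part of \<open>t\<close> is the product of \<open>f\<close> applied to the mixed parts of \<open>u\<close> and \<open>v\<close> and of the
  defect \<open>f(a\<^sub>1 b\<^sub>1, a\<^sub>2 b\<^sub>2) / (f(a\<^sub>1, a\<^sub>2) f(b\<^sub>1, b\<^sub>2))\<close>, where \<open>a\<^sub>1 = u(x,1)\<close>, \<open>a\<^sub>2 = v(x,1)\<close>
  and \<open>b\<^sub>1 = u(1,y)\<close>, \<open>b\<^sub>2 = v(1,y)\<close>. Defects are central, so mixed parts are central too.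
  Suppose that there is a fixed list of substitutions \<open>\<sigma>\<close> of the block, each of which factors through
  fewer than \<open>m\<close> variables, such that in \<open>L\<close> every defect is the product of the defects obtained
  by substituting \<open>\<sigma>\<close> for \<open>y\<close> in \<open>b\<^sub>1\<close> and \<open>b\<^sub>2\<close>. This is a family of identities in \<open>m + 2\<close>
  variables, so it passes to \<open>M\<close>, and induction on \<open>t\<close> shows that the mixed part of \<open>t\<close> in \<open>M\<close> is the
  product of its mixed parts at the points \<open>(x, \<sigma> y)\<close>. If now \<open>t = 1\<close> holds in \<open>L\<close>,
  then \<open>t(x,1)\<close>, \<open>t(1,y)\<close> and all \<open>t(x, \<sigma> y)\<close> are instances of identities of \<open>L\<close> in fewer
  variables, hence are \<open>1\<close> in \<open>M\<close> by induction on the number of variables. Therefore all the mixed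
  parts are \<open>1\<close>, and \<open>t(x,y) = 1\<close> holds in \<open>M\<close> (\<open>identities_bounded_variables\<close>).

  In an abelian group all defects are trivial, and the empty list works. Otherwise
  a defect in \<open>L\<close> takes values in the center, a copy of the integers modulo \<open>r\<close>, and depends on its
  arguments only modulo the center. As a function of the block it has the form
  \<open>y \<mapsto> \<Psi>(k \<bullet> y, l \<bullet> y)\<close> with linear forms \<open>k\<close> and \<open>l\<close> over the integers modulo \<open>s\<close>, and the
  required list must reproduce all functions of this form. If \<open>r \<noteq> s\<close>, then \<open>m = 2\<close> suffices:
  averaging over affine lines in the plane over the field with \<open>s\<close> elements expresses any function
  by its restrictions to lines through the origin, and \<open>s\<close> can be inverted modulo \<open>r\<close>
  (\<open>radon_inversion\<close>). If \<open>r = s\<close> and \<open>m = r\<^sup>3\<close>, then the pairs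
  \<open>(k\<^sub>i y\<^sub>i, l\<^sub>i y\<^sub>i)\<close> coincide modulo \<open>r\<close> for \<open>r\<close> of the indices \<open>i\<close>, and therefore the alternating sum of the
  values obtained by setting some of the variables to \<open>1\<close> vanishes: it contains inner sums with the
  binomial coefficients of \<open>r\<close>, which are divisible by \<open>r\<close> except for the two outermost ones,
  and the contributions of these two cancel modulo \<open>r\<close> (\<open>alternating_subset_sum\<close>).
\<close>

section \<open>Terms, identities and the three loop operations\<close>

text \<open>The three binary operations are indexed by a type, so that an argument common to multiplication
  and both divisions is given once.\<close>

datatype loop_op = Times | Under | Over

primrec apply_op :: "('a, 'm) loop_scheme \<Rightarrow> loop_op \<Rightarrow> 'a \<Rightarrow> 'a \<Rightarrow> 'a" where
  "apply_op L Times = monoid.mult L"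
| "apply_op L Under = ldiv L"
| "apply_op L Over = rdiv L"

primrec term_op :: "loop_op \<Rightarrow> 'v lterm \<Rightarrow> 'v lterm \<Rightarrow> 'v lterm" where
  "term_op Times = Mult"
| "term_op Under = LDiv"
| "term_op Over = RDiv"

lemma eval_term_op [simp]:
  "eval_lterm L e (term_op f s t) = apply_op L f (eval_lterm L e s) (eval_lterm L e t)"
  by (cases f) auto

lemma subst_term_op [simp]:
  "subst_lterm \<sigma> (term_op f s t) = term_op f (subst_lterm \<sigma> s) (subst_lterm \<sigma> t)"
  by (cases f) auto

lemma set_term_op [simp]: "set_lterm (term_op f s t) = set_lterm s \<union> set_lterm t"
  by (cases f) auto

lemma lterm_op_induct [case_names Var One Op]:
  assumes "\<And>v. P (Var v)" "P One" "\<And>f s t. P s \<Longrightarrow> P t \<Longrightarrow> P (term_op f s t)"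
  shows "P t"
  by (induction t) (use assms(1,2) assms(3)[of _ _ Times] assms(3)[of _ _ Under] assms(3)[of _ _ Over] in auto)

lemma eval_subst: "eval_lterm L e (subst_lterm \<sigma> t) = eval_lterm L (\<lambda>v. eval_lterm L e (\<sigma> v)) t"
  by (induction t) auto

lemma subst_subst: "subst_lterm \<sigma> (subst_lterm \<tau> t) = subst_lterm (\<lambda>v. subst_lterm \<sigma> (\<tau> v)) t"
  by (induction t) auto

lemma subst_Var [simp]: "subst_lterm Var t = t"
  by (induction t) auto

lemma subst_cong: "(\<And>v. v \<in> set_lterm t \<Longrightarrow> \<sigma> v = \<tau> v) \<Longrightarrow> subst_lterm \<sigma> t = subst_lterm \<tau> t"
  by (induction t) auto

lemma set_subst: "set_lterm (subst_lterm \<sigma> t) = (\<Union>v\<in>set_lterm t. set_lterm (\<sigma> v))"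
  by (induction t) auto

lemma eval_cong: "(\<And>v. v \<in> set_lterm t \<Longrightarrow> e v = e' v) \<Longrightarrow> eval_lterm L e t = eval_lterm L e' t"
  by (induction t) auto

lemma finite_set_lterm: "finite (set_lterm t)"
  by (induction t) auto

lemma holds_inI:
  "(\<And>e. (\<And>i. e i \<in> carrier L) \<Longrightarrow> eval_lterm L e s = eval_lterm L e t) \<Longrightarrow> holds_in L (s, t)"
  by (auto simp: holds_in_def)

lemma holds_inD: "holds_in L (s, t) \<Longrightarrow> (\<And>i. e i \<in> carrier L) \<Longrightarrow> eval_lterm L e s = eval_lterm L e t"
  by (auto simp: holds_in_def)

text \<open>Being a loop is a closure condition together with identities in two variables; this is how it is
  verified for quotients of loops and for algebras of terms modulo derivability.\<close>

definition loop_laws :: "identity set" where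
  "loop_laws = {(LDiv (Var 0) (Mult (Var 0) (Var 1)), Var 1), (Mult (Var 0) (LDiv (Var 0) (Var 1)), Var 1),
    (RDiv (Mult (Var 1) (Var 0)) (Var 0), Var 1), (Mult (RDiv (Var 1) (Var 0)) (Var 0), Var 1),
    (Mult (Var 0) One, Var 0), (Mult One (Var 0), Var 0)}"

lemma loop_if_laws:
  assumes cl: "\<And>f x y. x \<in> carrier L \<Longrightarrow> y \<in> carrier L \<Longrightarrow> apply_op L f x y \<in> carrier L"
    and one: "\<one>\<^bsub>L\<^esub> \<in> carrier L"
    and laws: "\<And>\<epsilon>. \<epsilon> \<in> loop_laws \<Longrightarrow> holds_in L \<epsilon>"
  shows "loop L"
proof -
  have *: "eval_lterm L (\<lambda>i. if i = 0 then x else y) s = eval_lterm L (\<lambda>i. if i = 0 then x else y) t"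
    if "(s, t) \<in> loop_laws" "x \<in> carrier L" "y \<in> carrier L" for s t x y
    using laws[OF that(1)] that(2,3) by (auto simp: holds_in_def)
  note ** = *[unfolded loop_laws_def]
  show ?thesis
  proof
    fix x y assume x: "x \<in> carrier L" "y \<in> carrier L"
    show "x \<otimes>\<^bsub>L\<^esub> y \<in> carrier L" "ldiv L x y \<in> carrier L" "rdiv L x y \<in> carrier L"
      using cl[OF x, of Times] cl[OF x, of Under] cl[OF x, of Over] by auto
    show "ldiv L x (x \<otimes>\<^bsub>L\<^esub> y) = y" "x \<otimes>\<^bsub>L\<^esub> ldiv L x y = y"
      "rdiv L (y \<otimes>\<^bsub>L\<^esub> x) x = y" "rdiv L y x \<otimes>\<^bsub>L\<^esub> x = y"
      using **[OF _ x, of "LDiv (Var 0) (Mult (Var 0) (Var 1))" "Var 1"]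
       **[OF _ x, of "Mult (Var 0) (LDiv (Var 0) (Var 1))" "Var 1"]
       **[OF _ x, of "RDiv (Mult (Var 1) (Var 0)) (Var 0)" "Var 1"]
       **[OF _ x, of "Mult (RDiv (Var 1) (Var 0)) (Var 0)" "Var 1"] by simp_all
  next
    fix x assume x: "x \<in> carrier L"
    show "x \<otimes>\<^bsub>L\<^esub> \<one>\<^bsub>L\<^esub> = x" "\<one>\<^bsub>L\<^esub> \<otimes>\<^bsub>L\<^esub> x = x"
      using **[OF _ x x, of "Mult (Var 0) One" "Var 0"] **[OF _ x x, of "Mult One (Var 0)" "Var 0"] by simp_all
  qed (use one in auto)
qed

lemma (in loop) laws_hold: "\<epsilon> \<in> loop_laws \<Longrightarrow> holds_in L \<epsilon>"
  by (auto simp: loop_laws_def holds_in_def ldiv_mult mult_ldiv rdiv_mult mult_rdiv r_one l_one)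

context loop
begin

lemmas loop_closed = m_closed ldiv_closed rdiv_closed one_closed

lemma op_closed: "x \<in> carrier L \<Longrightarrow> y \<in> carrier L \<Longrightarrow> apply_op L f x y \<in> carrier L"
  by (cases f) (auto intro: loop_closed)

lemma eval_closed: "(\<And>i. e i \<in> carrier L) \<Longrightarrow> eval_lterm L e t \<in> carrier L"
  by (rule eval_lterm_closed)

lemma l_cancel: "x \<otimes> y = x \<otimes> z \<Longrightarrow> x \<in> carrier L \<Longrightarrow> y \<in> carrier L \<Longrightarrow> z \<in> carrier L \<Longrightarrow> y = z"
  by (metis ldiv_mult)

lemma ldiv_eqI: "x \<otimes> z = y \<Longrightarrow> x \<in> carrier L \<Longrightarrow> z \<in> carrier L \<Longrightarrow> ldiv L x y = z"
  using ldiv_mult by blast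

lemma rdiv_eqI: "z \<otimes> x = y \<Longrightarrow> x \<in> carrier L \<Longrightarrow> z \<in> carrier L \<Longrightarrow> rdiv L y x = z"
  using rdiv_mult by blast

lemma rdiv_eq_one_iff: "x \<in> carrier L \<Longrightarrow> y \<in> carrier L \<Longrightarrow> rdiv L x y = \<one> \<longleftrightarrow> x = y"
  by (metis l_one mult_rdiv one_closed rdiv_eqI)

end

section \<open>The center of a loop\<close>

text \<open>The remaining associativity condition, with the central element in the middle, follows from
  commutation and the two conditions below (\<open>center_assoc2\<close>).\<close>

definition loop_center :: "('a, 'm) loop_scheme \<Rightarrow> 'a set" where
  "loop_center L = {z \<in> carrier L. \<forall>x\<in>carrier L. z \<otimes>\<^bsub>L\<^esub> x = x \<otimes>\<^bsub>L\<^esub> z \<and>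
     (\<forall>y\<in>carrier L. z \<otimes>\<^bsub>L\<^esub> (x \<otimes>\<^bsub>L\<^esub> y) = (z \<otimes>\<^bsub>L\<^esub> x) \<otimes>\<^bsub>L\<^esub> y \<and>
        x \<otimes>\<^bsub>L\<^esub> (y \<otimes>\<^bsub>L\<^esub> z) = (x \<otimes>\<^bsub>L\<^esub> y) \<otimes>\<^bsub>L\<^esub> z)}"

context loop
begin

lemma center_closed: "z \<in> loop_center L \<Longrightarrow> z \<in> carrier L"
  by (simp add: loop_center_def)

lemma center_comm: "z \<in> loop_center L \<Longrightarrow> x \<in> carrier L \<Longrightarrow> z \<otimes> x = x \<otimes> z"
  by (simp add: loop_center_def)

lemma center_assoc1: "z \<in> loop_center L \<Longrightarrow> x \<in> carrier L \<Longrightarrow> y \<in> carrier L \<Longrightarrow> z \<otimes> (x \<otimes> y) = (z \<otimes> x) \<otimes> y"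
  by (simp add: loop_center_def)

lemma center_assoc3: "z \<in> loop_center L \<Longrightarrow> x \<in> carrier L \<Longrightarrow> y \<in> carrier L \<Longrightarrow> x \<otimes> (y \<otimes> z) = (x \<otimes> y) \<otimes> z"
  by (simp add: loop_center_def)

lemma center_assoc2: "z \<in> loop_center L \<Longrightarrow> x \<in> carrier L \<Longrightarrow> y \<in> carrier L \<Longrightarrow> x \<otimes> (z \<otimes> y) = (x \<otimes> z) \<otimes> y"
  using center_comm center_assoc1 center_assoc3 m_closed by metis

lemma one_center: "\<one> \<in> loop_center L"
  by (auto simp: loop_center_def one_closed r_one l_one m_closed)

lemma center_mult:
  assumes z: "z \<in> loop_center L" and w: "w \<in> loop_center L"
  shows "z \<otimes> w \<in> loop_center L"
proof -
  note c = center_closed[OF z] center_closed[OF w]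
  have "z \<otimes> w \<otimes> x = x \<otimes> (z \<otimes> w)" if x: "x \<in> carrier L" for x
    using x c by (metis center_assoc1[OF z] center_assoc3[OF w] center_comm[OF z] center_comm[OF w] m_closed)
  moreover have "z \<otimes> w \<otimes> (x \<otimes> y) = (z \<otimes> w \<otimes> x) \<otimes> y" if x: "x \<in> carrier L" "y \<in> carrier L" for x y
    using x c by (metis center_assoc1[OF z] center_assoc1[OF w] m_closed)
  moreover have "x \<otimes> (y \<otimes> (z \<otimes> w)) = (x \<otimes> y) \<otimes> (z \<otimes> w)" if x: "x \<in> carrier L" "y \<in> carrier L" for x y
    using x c by (metis center_assoc3[OF z] center_assoc3[OF w] m_closed)
  ultimately show ?thesis using c by (simp add: loop_center_def m_closed)
qed

lemma center_inverse:
  assumes z: "z \<in> loop_center L"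
  shows "ldiv L z \<one> \<in> loop_center L"
proof -
  define i where "i = ldiv L z \<one>"
  note c = center_closed[OF z]
  have i: "i \<in> carrier L" "z \<otimes> i = \<one>" using c by (auto simp: i_def mult_ldiv one_closed ldiv_closed)
  have zi: "z \<otimes> (i \<otimes> x) = x" if "x \<in> carrier L" for x
    using that i z center_assoc1 l_one by metis
  have iz: "z \<otimes> (x \<otimes> i) = x" if "x \<in> carrier L" for x
    using that i z center_assoc2 r_one center_comm center_assoc1 by metis
  have "i \<otimes> x = x \<otimes> i" if "x \<in> carrier L" for x
    using that zi iz i c l_cancel m_closed by metis
  moreover have "i \<otimes> (x \<otimes> y) = (i \<otimes> x) \<otimes> y" if x: "x \<in> carrier L" "y \<in> carrier L" for x y
  proof (rule l_cancel[of z])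
    show "z \<otimes> (i \<otimes> (x \<otimes> y)) = z \<otimes> (i \<otimes> x \<otimes> y)"
      using x i z zi[of "x \<otimes> y"] zi[of x] center_assoc1[OF z, of "i \<otimes> x" y] by (auto simp: m_closed)
  qed (use x i c in \<open>auto intro: m_closed\<close>)
  moreover have "x \<otimes> (y \<otimes> i) = (x \<otimes> y) \<otimes> i" if x: "x \<in> carrier L" "y \<in> carrier L" for x y
  proof (rule l_cancel[of z])
    have "z \<otimes> (x \<otimes> (y \<otimes> i)) = x \<otimes> (z \<otimes> (y \<otimes> i))"
      using x i z c by (metis center_assoc1 center_assoc2 center_comm m_closed)
    then show "z \<otimes> (x \<otimes> (y \<otimes> i)) = z \<otimes> (x \<otimes> y \<otimes> i)"
      using x iz[of y] iz[of "x \<otimes> y"] by (auto simp: m_closed)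
  qed (use x i c in \<open>auto intro: m_closed\<close>)
  ultimately show ?thesis using i by (simp add: loop_center_def i_def)
qed

lemma center_mult_interchange:
  assumes z: "z \<in> loop_center L" and w: "w \<in> loop_center L" and x: "x \<in> carrier L" "y \<in> carrier L"
  shows "(x \<otimes> z) \<otimes> (y \<otimes> w) = (x \<otimes> y) \<otimes> (z \<otimes> w)"
proof -
  note c = center_closed[OF z] center_closed[OF w]
  have "(x \<otimes> z) \<otimes> (y \<otimes> w) = ((x \<otimes> z) \<otimes> y) \<otimes> w"
    using x c center_assoc3[OF w] by (simp add: m_closed)
  also have "(x \<otimes> z) \<otimes> y = (x \<otimes> y) \<otimes> z"
    using x c by (metis center_assoc2[OF z] center_assoc3[OF z] center_comm[OF z])
  also have "((x \<otimes> y) \<otimes> z) \<otimes> w = (x \<otimes> y) \<otimes> (z \<otimes> w)"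
    using x c center_assoc3[OF w] by (simp add: m_closed)
  finally show ?thesis .
qed

lemma center_op:
  assumes z: "z \<in> loop_center L" and w: "w \<in> loop_center L"
  shows "apply_op L f z w \<in> loop_center L"
proof -
  note c = center_closed[OF z] center_closed[OF w]
  have U: "ldiv L z w = ldiv L z \<one> \<otimes> w" if "z \<in> loop_center L" "w \<in> carrier L" for z w
    using that by (intro ldiv_eqI)
      (auto simp: center_assoc1 mult_ldiv one_closed l_one ldiv_closed center_closed m_closed)
  have O: "rdiv L z w = ldiv L w z"
    using c by (intro rdiv_eqI) (metis center_comm[OF w] mult_ldiv ldiv_closed, auto simp: ldiv_closed)
  show ?thesis
    by (cases f) (use c z w in \<open>auto simp: U O center_mult center_inverse\<close>)
qed

text \<open>Central factors can be pulled out of all three operations.\<close>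

text \<open>All three operations are homomorphisms with respect to multiplication by central elements. For the
  divisions this is the case of multiplication, read as the uniqueness of quotients.\<close>

lemma op_center_interchange:
  assumes z: "z \<in> loop_center L" and w: "w \<in> loop_center L" and x: "x \<in> carrier L" "y \<in> carrier L"
  shows "apply_op L f (x \<otimes> z) (y \<otimes> w) = apply_op L f x y \<otimes> apply_op L f z w"
proof -
  note c = center_closed[OF z] center_closed[OF w]
  have d: "ldiv L z w \<in> loop_center L" "rdiv L z w \<in> loop_center L"
    using center_op[OF z w, of Under] center_op[OF z w, of Over] by auto
  show ?thesis
  proof (cases f)
    case Times
    then show ?thesis using center_mult_interchange[OF z w x] by simp
  next
    case Under
    have "(x \<otimes> z) \<otimes> (ldiv L x y \<otimes> ldiv L z w) = y \<otimes> w"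
      using center_mult_interchange[OF z d(1), of x "ldiv L x y"] x c by (simp add: ldiv_closed mult_ldiv)
    then show ?thesis using Under x c by (auto intro!: ldiv_eqI m_closed ldiv_closed)
  next
    case Over
    have "(rdiv L x y \<otimes> rdiv L z w) \<otimes> (y \<otimes> w) = x \<otimes> z"
      using center_mult_interchange[OF d(2) w, of "rdiv L x y" y] x c by (simp add: rdiv_closed mult_rdiv)
    then show ?thesis using Over x c by (auto intro!: rdiv_eqI m_closed rdiv_closed)
  qed
qed

lemma op_one: "apply_op L f \<one> \<one> = \<one>"
  by (cases f) (auto intro!: ldiv_eqI rdiv_eqI simp: one_closed l_one)

end

section \<open>The interchange defect of an operation\<close>

text \<open>The defect measures how far the operation \<open>f\<close> is from being a homomorphism from the square of the
  loop. For multiplication in a group it is a conjugate of the commutator of \<open>b\<^sub>1\<close> and \<open>a\<^sub>2\<close>.\<close>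

definition defect :: "('a, 'm) loop_scheme \<Rightarrow> loop_op \<Rightarrow> 'a \<Rightarrow> 'a \<Rightarrow> 'a \<Rightarrow> 'a \<Rightarrow> 'a" where
  "defect L f a\<^sub>1 a\<^sub>2 b\<^sub>1 b\<^sub>2 =
     rdiv L (apply_op L f (a\<^sub>1 \<otimes>\<^bsub>L\<^esub> b\<^sub>1) (a\<^sub>2 \<otimes>\<^bsub>L\<^esub> b\<^sub>2))
            (apply_op L f a\<^sub>1 a\<^sub>2 \<otimes>\<^bsub>L\<^esub> apply_op L f b\<^sub>1 b\<^sub>2)"

definition defect_term :: "loop_op \<Rightarrow> 'v lterm \<Rightarrow> 'v lterm \<Rightarrow> 'v lterm \<Rightarrow> 'v lterm \<Rightarrow> 'v lterm" where
  "defect_term f a\<^sub>1 a\<^sub>2 b\<^sub>1 b\<^sub>2 =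
     RDiv (term_op f (Mult a\<^sub>1 b\<^sub>1) (Mult a\<^sub>2 b\<^sub>2)) (Mult (term_op f a\<^sub>1 a\<^sub>2) (term_op f b\<^sub>1 b\<^sub>2))"

lemma eval_defect_term [simp]:
  "eval_lterm L e (defect_term f a\<^sub>1 a\<^sub>2 b\<^sub>1 b\<^sub>2) =
     defect L f (eval_lterm L e a\<^sub>1) (eval_lterm L e a\<^sub>2) (eval_lterm L e b\<^sub>1) (eval_lterm L e b\<^sub>2)"
  by (simp add: defect_def defect_term_def)

lemma set_defect_term [simp]:
  "set_lterm (defect_term f a\<^sub>1 a\<^sub>2 b\<^sub>1 b\<^sub>2) = set_lterm a\<^sub>1 \<union> set_lterm a\<^sub>2 \<union> set_lterm b\<^sub>1 \<union> set_lterm b\<^sub>2"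
  by (auto simp: defect_term_def)

lemma (in loop) defect_closed:
  "a\<^sub>1 \<in> carrier L \<Longrightarrow> a\<^sub>2 \<in> carrier L \<Longrightarrow> b\<^sub>1 \<in> carrier L \<Longrightarrow> b\<^sub>2 \<in> carrier L \<Longrightarrow>
    defect L f a\<^sub>1 a\<^sub>2 b\<^sub>1 b\<^sub>2 \<in> carrier L"
  by (auto simp: defect_def intro!: rdiv_closed op_closed m_closed)

lemma (in loop) defect_mult:
  "a\<^sub>1 \<in> carrier L \<Longrightarrow> a\<^sub>2 \<in> carrier L \<Longrightarrow> b\<^sub>1 \<in> carrier L \<Longrightarrow> b\<^sub>2 \<in> carrier L \<Longrightarrow>
    defect L f a\<^sub>1 a\<^sub>2 b\<^sub>1 b\<^sub>2 \<otimes> (apply_op L f a\<^sub>1 a\<^sub>2 \<otimes> apply_op L f b\<^sub>1 b\<^sub>2)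
      = apply_op L f (a\<^sub>1 \<otimes> b\<^sub>1) (a\<^sub>2 \<otimes> b\<^sub>2)"
  by (auto simp: defect_def mult_rdiv op_closed m_closed)

section \<open>Quotients by congruences\<close>

text \<open>The construction is used twice: for the quotient of a loop by its center, and for terms modulo
  derivability. The latter starts from an algebra that is not a loop, so the facts about quotients
  are stated for arbitrary algebras with a closed carrier.\<close>

definition loop_quotient :: "('a, 'm) loop_scheme \<Rightarrow> 'a rel \<Rightarrow> 'a set loop" where
  "loop_quotient L \<theta> = \<lparr>carrier = carrier L // \<theta>,
     monoid.mult = (\<lambda>X Y. \<theta> `` {(SOME x. x \<in> X) \<otimes>\<^bsub>L\<^esub> (SOME y. y \<in> Y)}),
     one = \<theta> `` {\<one>\<^bsub>L\<^esub>},
     ldiv = (\<lambda>X Y. \<theta> `` {ldiv L (SOME x. x \<in> X) (SOME y. y \<in> Y)}),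
     rdiv = (\<lambda>X Y. \<theta> `` {rdiv L (SOME x. x \<in> X) (SOME y. y \<in> Y)})\<rparr>"

lemma congruence_op:
  "loop_congruence L \<theta> \<Longrightarrow> (x, x') \<in> \<theta> \<Longrightarrow> (y, y') \<in> \<theta> \<Longrightarrow> (apply_op L f x y, apply_op L f x' y') \<in> \<theta>"
  by (cases f) (auto simp: loop_congruence_def)

lemma loop_congruenceI:
  "equiv (carrier L) \<theta> \<Longrightarrow>
   (\<And>f x x' y y'. (x, x') \<in> \<theta> \<Longrightarrow> (y, y') \<in> \<theta> \<Longrightarrow> (apply_op L f x y, apply_op L f x' y') \<in> \<theta>) \<Longrightarrow>
   loop_congruence L \<theta>"
  unfolding loop_congruence_def
  by (metis apply_op.simps)

context
  fixes L :: "('a, 'm) loop_scheme" and \<theta> :: "'a rel"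
  assumes \<theta>: "loop_congruence L \<theta>"
begin

lemma congruence_equiv: "equiv (carrier L) \<theta>"
  using \<theta> by (simp add: loop_congruence_def)

lemma congruence_refl: "x \<in> carrier L \<Longrightarrow> (x, x) \<in> \<theta>"
  using congruence_equiv by (auto simp: equiv_def refl_on_def)

lemma congruence_carrier: "(x, y) \<in> \<theta> \<Longrightarrow> x \<in> carrier L \<and> y \<in> carrier L"
  using congruence_equiv by (auto simp: equiv_def refl_on_def)

lemma congruence_closed: "x \<in> carrier L \<Longrightarrow> y \<in> carrier L \<Longrightarrow> apply_op L f x y \<in> carrier L"
  using congruence_op[OF \<theta>, of x x y y f] congruence_refl congruence_carrier by blast

lemma class_eq_iff: "x \<in> carrier L \<Longrightarrow> y \<in> carrier L \<Longrightarrow> \<theta> `` {x} = \<theta> `` {y} \<longleftrightarrow> (x, y) \<in> \<theta>"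
  using congruence_equiv by (simp add: eq_equiv_class_iff)

lemma quotient_carrierE:
  assumes "X \<in> carrier (loop_quotient L \<theta>)"
  obtains x where "x \<in> carrier L" "X = \<theta> `` {x}"
  using assms by (auto simp: loop_quotient_def elim: quotientE)

lemma quotient_carrierI: "x \<in> carrier L \<Longrightarrow> \<theta> `` {x} \<in> carrier (loop_quotient L \<theta>)"
  by (simp add: loop_quotient_def quotientI)

lemma quotient_op:
  assumes x: "x \<in> carrier L" and y: "y \<in> carrier L"
  shows "apply_op (loop_quotient L \<theta>) f (\<theta> `` {x}) (\<theta> `` {y}) = \<theta> `` {apply_op L f x y}"
proof -
  have *: "(x, SOME x'. x' \<in> \<theta> `` {x}) \<in> \<theta>" if "x \<in> carrier L" for x
    using someI[of "\<lambda>x'. x' \<in> \<theta> `` {x}" x] congruence_refl[OF that] by auto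
  have "\<theta> `` {apply_op L f (SOME x'. x' \<in> \<theta> `` {x}) (SOME y'. y' \<in> \<theta> `` {y})} = \<theta> `` {apply_op L f x y}"
    using congruence_op[OF \<theta> *[OF x] *[OF y]] congruence_equiv by (intro equiv_class_eq[symmetric])
  then show ?thesis by (cases f) (auto simp: loop_quotient_def)
qed

lemma quotient_eval:
  assumes one: "\<one>\<^bsub>L\<^esub> \<in> carrier L" and e: "\<And>v. e v \<in> carrier L"
  shows "eval_lterm L e t \<in> carrier L \<and>
    eval_lterm (loop_quotient L \<theta>) (\<lambda>v. \<theta> `` {e v}) t = \<theta> `` {eval_lterm L e t}"
proof (induction t rule: lterm_op_induct)
  case One
  then show ?case by (simp add: one loop_quotient_def)
next
  case (Op f s t)
  then show ?case by (simp add: quotient_op congruence_closed)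
qed (simp add: e)

lemma quotient_holds_in_iff:
  assumes one: "\<one>\<^bsub>L\<^esub> \<in> carrier L"
  shows "holds_in (loop_quotient L \<theta>) (s, t) \<longleftrightarrow>
    (\<forall>e. (\<forall>v. e v \<in> carrier L) \<longrightarrow> (eval_lterm L e s, eval_lterm L e t) \<in> \<theta>)"
proof
  assume *: "holds_in (loop_quotient L \<theta>) (s, t)"
  show "\<forall>e. (\<forall>v. e v \<in> carrier L) \<longrightarrow> (eval_lterm L e s, eval_lterm L e t) \<in> \<theta>"
  proof (intro allI impI)
    fix e :: "nat \<Rightarrow> 'a" assume e: "\<forall>v. e v \<in> carrier L"
    then have "\<theta> `` {eval_lterm L e s} = \<theta> `` {eval_lterm L e t}"
      using holds_inD[OF *, of "\<lambda>v. \<theta> `` {e v}"] quotient_eval[OF one, of e] quotient_carrierI by simp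
    then show "(eval_lterm L e s, eval_lterm L e t) \<in> \<theta>"
      using class_eq_iff quotient_eval[OF one, of e] e by auto
  qed
next
  assume *: "\<forall>e. (\<forall>v. e v \<in> carrier L) \<longrightarrow> (eval_lterm L e s, eval_lterm L e t) \<in> \<theta>"
  show "holds_in (loop_quotient L \<theta>) (s, t)"
  proof (rule holds_inI)
    fix E :: "nat \<Rightarrow> _" assume "\<And>i. E i \<in> carrier (loop_quotient L \<theta>)"
    then have "\<forall>i. \<exists>x\<in>carrier L. E i = \<theta> `` {x}" by (metis quotient_carrierE)
    then obtain e where e: "\<And>i. e i \<in> carrier L" "E = (\<lambda>i. \<theta> `` {e i})" by metis
    then show "eval_lterm (loop_quotient L \<theta>) E s = eval_lterm (loop_quotient L \<theta>) E t"
      using quotient_eval[OF one, of e] * class_eq_iff by simp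
  qed
qed

lemma quotient_loop:
  assumes one: "\<one>\<^bsub>L\<^esub> \<in> carrier L"
    and laws: "\<And>\<epsilon>. \<epsilon> \<in> loop_laws \<Longrightarrow> holds_in (loop_quotient L \<theta>) \<epsilon>"
  shows "loop (loop_quotient L \<theta>)"
proof (rule loop_if_laws)
  fix f X Y assume "X \<in> carrier (loop_quotient L \<theta>)" "Y \<in> carrier (loop_quotient L \<theta>)"
  then show "apply_op (loop_quotient L \<theta>) f X Y \<in> carrier (loop_quotient L \<theta>)"
    by (elim quotient_carrierE) (simp add: quotient_op quotient_carrierI congruence_closed)
next
  show "\<one>\<^bsub>loop_quotient L \<theta>\<^esub> \<in> carrier (loop_quotient L \<theta>)"
    using one by (simp add: loop_quotient_def quotientI)
qed (fact laws)

end

lemma (in loop) quotient_is_loop: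
  assumes \<theta>: "loop_congruence L \<theta>"
  shows "loop (loop_quotient L \<theta>)"
proof (rule quotient_loop[OF \<theta> one_closed])
  fix \<epsilon> assume "\<epsilon> \<in> loop_laws"
  then show "holds_in (loop_quotient L \<theta>) \<epsilon>"
    using laws_hold[of \<epsilon>] quotient_holds_in_iff[OF \<theta> one_closed]
    by (cases \<epsilon>) (metis holds_inD congruence_refl[OF \<theta>] eval_closed)
qed

section \<open>A finite basis for the identities in boundedly many variables\<close>

text \<open>The terms modulo derivability form the free algebra of the variety axiomatized by \<open>B\<close>; an identity
  holds in it exactly when it is derivable. This turns derivations into calculations in a loop.\<close>

definition term_algebra :: "nat lterm loop" where
  "term_algebra = \<lparr>carrier = UNIV, monoid.mult = Mult, one = One, ldiv = LDiv, rdiv = RDiv\<rparr>"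

lemma carrier_term_algebra [simp]: "carrier term_algebra = UNIV"
  by (simp add: term_algebra_def)

lemma eval_term_algebra [simp]: "eval_lterm term_algebra \<sigma> t = subst_lterm \<sigma> t"
  by (induction t) (auto simp: term_algebra_def)

definition derivability :: "identity set \<Rightarrow> nat lterm rel" where
  "derivability B = {(s, t). eq_derivable B s t}"

lemma derivability_congruence: "loop_congruence term_algebra (derivability B)"
  unfolding loop_congruence_def equiv_def refl_on_def sym_def trans_def derivability_def
  by (auto simp: term_algebra_def intro: eq_derivable.intros)

lemma derivable_op:
  "eq_derivable B s s' \<Longrightarrow> eq_derivable B t t' \<Longrightarrow> eq_derivable B (term_op f s t) (term_op f s' t')"
  by (cases f) (auto intro: eq_derivable.intros)

lemma derivable_subst: "eq_derivable B s t \<Longrightarrow> eq_derivable B (subst_lterm \<sigma> s) (subst_lterm \<sigma> t)"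
proof (induction rule: eq_derivable.induct)
  case (inst s t \<tau>)
  then show ?case by (simp add: subst_subst eq_derivable.inst)
qed (auto intro: eq_derivable.intros)

lemma holds_in_free_algebra_iff:
  "holds_in (loop_quotient term_algebra (derivability B)) (s, t) \<longleftrightarrow> eq_derivable B s t"
proof -
  have "holds_in (loop_quotient term_algebra (derivability B)) (s, t) \<longleftrightarrow>
      (\<forall>\<sigma>. eq_derivable B (subst_lterm \<sigma> s) (subst_lterm \<sigma> t))"
    by (subst quotient_holds_in_iff[OF derivability_congruence]) (auto simp: derivability_def)
  then show ?thesis using derivable_subst subst_Var by metis
qed

text \<open>Birkhoff's argument: terms in \<open>N\<close> variables induce only finitely many operations on a finite loop.
  Fix one representative \<open>\<rho>\<close> for each of them. The finitely many identities that reduce a variable,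
  the unit, or an operation applied to representatives to a representative suffice to rewrite every
  term to its representative.\<close>

lemma finitely_many_variables_basis:
  fixes L :: "('a, 'm) loop_scheme"
  assumes L: "loop L" and fin: "finite (carrier L)"
  obtains B where "finite B" "\<And>\<epsilon>. \<epsilon> \<in> B \<Longrightarrow> holds_in L \<epsilon>"
    "\<And>s t. set_lterm s \<subseteq> {..<N} \<Longrightarrow> set_lterm t \<subseteq> {..<N} \<Longrightarrow> holds_in L (s, t) \<Longrightarrow> eq_derivable B s t"
proof -
  interpret loop L by fact
  define E where "E = (\<Pi>\<^sub>E i\<in>{..<N}. carrier L)"
  define K :: "nat lterm \<Rightarrow> (nat \<Rightarrow> 'a) \<Rightarrow> 'a" where "K t = restrict (\<lambda>e. eval_lterm L e t) E" for t
  define T where "T = {t. set_lterm t \<subseteq> {..<N}}"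
  have finE: "finite E" unfolding E_def by (intro finite_PiE) (auto simp: fin)
  have ev: "eval_lterm L e t \<in> carrier L" if "e \<in> E" "t \<in> T" for e t
    using that by (intro eval_lterm_closed) (auto simp: E_def T_def)
  have K: "K s = K t \<longleftrightarrow> holds_in L (s, t)" if st: "s \<in> T" "t \<in> T" for s t
  proof
    assume eq: "K s = K t"
    show "holds_in L (s, t)"
    proof (rule holds_inI)
      fix e :: "nat \<Rightarrow> _" assume e: "\<And>i. e i \<in> carrier L"
      define e' where "e' = restrict e {..<N}"
      have e': "e' \<in> E" using e by (auto simp: e'_def E_def)
      have "eval_lterm L e r = eval_lterm L e' r" if "r \<in> T" for r
        using that by (intro eval_cong) (auto simp: e'_def T_def)
      moreover have "eval_lterm L e' s = eval_lterm L e' t"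
        using fun_cong[OF eq, of e'] e' by (simp add: K_def)
      ultimately show "eval_lterm L e s = eval_lterm L e t" using st by simp
    qed
  next
    assume h: "holds_in L (s, t)"
    show "K s = K t" unfolding K_def
    proof (rule restrict_ext)
      fix e :: "nat \<Rightarrow> _" assume e: "e \<in> E"
      define e' where "e' i = (if i < N then e i else \<one>\<^bsub>L\<^esub>)" for i
      have "e' i \<in> carrier L" for i using e one_closed by (auto simp: e'_def E_def)
      then have "eval_lterm L e' s = eval_lterm L e' t" using holds_inD[OF h] by blast
      moreover have "eval_lterm L e r = eval_lterm L e' r" if "r \<in> T" for r
        using that by (intro eval_cong) (auto simp: e'_def T_def)
      ultimately show "eval_lterm L e s = eval_lterm L e t" using st by simp
    qed
  qed
  define g where "g \<phi> = (SOME s. s \<in> T \<and> K s = \<phi>)" for \<phi>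
  define \<rho> where "\<rho> t = g (K t)" for t
  have \<rho>: "\<rho> t \<in> T \<and> K (\<rho> t) = K t" if "t \<in> T" for t
    unfolding \<rho>_def g_def by (rule someI_ex) (use that in blast)
  have finR: "finite (\<rho> ` T)"
  proof -
    have "K ` T \<subseteq> (\<Pi>\<^sub>E e\<in>E. carrier L)" using ev by (auto simp: K_def)
    then have "finite (K ` T)" by (rule finite_subset) (intro finite_PiE finE fin)
    then show ?thesis using finite_imageI[of "K ` T" g] by (simp add: \<rho>_def image_image)
  qed
  define G where "G = Var ` {..<N} \<union> {One} \<union> (\<lambda>(f, s, t). term_op f s t) ` ({Times, Under, Over} \<times> \<rho> ` T \<times> \<rho> ` T)"
  define B where "B = (\<lambda>t. (t, \<rho> t)) ` G"
  have GT: "G \<subseteq> T" using \<rho> by (fastforce simp: G_def T_def)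
  have B: "eq_derivable B t (\<rho> t)" if "t \<in> G" for t
    using eq_derivable.inst[of t "\<rho> t" B Var] that by (auto simp: B_def)
  have opsall: "f \<in> {Times, Under, Over}" for f by (cases f) auto
  have nf: "eq_derivable B t (\<rho> t)" if "t \<in> T" for t
    using that
  proof (induction t rule: lterm_op_induct)
    case (Op f s t)
    then have st: "s \<in> T" "t \<in> T" by (auto simp: T_def)
    let ?u = "term_op f (\<rho> s) (\<rho> t)"
    have "?u \<in> (\<lambda>(f, s, t). term_op f s t) ` ({Times, Under, Over} \<times> \<rho> ` T \<times> \<rho> ` T)"
      using st opsall[of f] by (intro image_eqI[where x = "(f, \<rho> s, \<rho> t)"]) auto
    then have u: "?u \<in> G" unfolding G_def by blast
    have Kop: "K (term_op f a b) = (\<lambda>e. if e \<in> E then apply_op L f (K a e) (K b e) else undefined)" for a b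
      by (auto simp: K_def)
    have "K ?u = K (term_op f s t)"
      using \<rho> st by (simp only: Kop)
    then have "\<rho> ?u = \<rho> (term_op f s t)" by (simp add: \<rho>_def)
    moreover have "eq_derivable B (term_op f s t) ?u" using Op st by (intro derivable_op) auto
    ultimately show ?case using B[OF u] eq_derivable.trans by metis
  qed (auto simp: T_def G_def intro!: B)
  show ?thesis
  proof (rule that)
    show "finite B" using finR by (auto simp: B_def G_def)
    show "holds_in L \<epsilon>" if "\<epsilon> \<in> B" for \<epsilon>
    proof -
      obtain t where t: "t \<in> T" "\<epsilon> = (t, \<rho> t)" using \<open>\<epsilon> \<in> B\<close> GT by (auto simp: B_def)
      then show ?thesis using K[of t "\<rho> t"] \<rho>[of t] by simp
    qed
    show "eq_derivable B s t" if "set_lterm s \<subseteq> {..<N}" "set_lterm t \<subseteq> {..<N}" "holds_in L (s, t)" for s t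
    proof -
      have st: "s \<in> T" "t \<in> T" using that by (auto simp: T_def)
      then have "\<rho> s = \<rho> t" using K[of s t] that(3) by (simp add: \<rho>_def)
      then show ?thesis using nf st eq_derivable.sym eq_derivable.trans by metis
    qed
  qed
qed

section \<open>Reducing the number of variables\<close>

text \<open>The terms \<open>P\<close> use a proper subset of the \<open>m\<close> variables, so that substituting \<open>\<sigma>\<close> into a term is an
  instance of a term with fewer variables. The variables of \<open>P\<close> are taken from the block itself to keep
  them apart from the variables outside the block.\<close>

definition degenerate_subst :: "nat \<Rightarrow> (nat \<Rightarrow> nat lterm) \<Rightarrow> bool" where
  "degenerate_subst m \<sigma> \<longleftrightarrow> (\<forall>i<m. set_lterm (\<sigma> i) \<subseteq> {..<m}) \<and>
     (\<exists>P Q. (\<forall>i<m. \<sigma> i = subst_lterm Q (P i)) \<and> (\<Union>i<m. set_lterm (P i)) \<subset> {..<m})"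

definition loop_product :: "('a, 'm) loop_scheme \<Rightarrow> 'a list \<Rightarrow> 'a" where
  "loop_product L xs = foldr (\<lambda>x y. x \<otimes>\<^bsub>L\<^esub> y) xs \<one>\<^bsub>L\<^esub>"

lemma loop_product_simps [simp]:
  "loop_product L [] = \<one>\<^bsub>L\<^esub>" "loop_product L (x # xs) = x \<otimes>\<^bsub>L\<^esub> loop_product L xs"
  by (simp_all add: loop_product_def)

definition product_term :: "nat lterm list \<Rightarrow> nat lterm" where
  "product_term ts = foldr Mult ts One"

lemma eval_product_term: "eval_lterm L e (product_term ts) = loop_product L (map (eval_lterm L e) ts)"
  by (induction ts) (auto simp: product_term_def)

lemma set_product_term: "set_lterm (product_term ts) = (\<Union>t\<in>set ts. set_lterm t)"
  by (induction ts) (auto simp: product_term_def)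

text \<open>The relation used to remove variables: a defect, as a function of a block \<open>y\<close> of \<open>m\<close> variables, is the
  product of its values at the degenerate points \<open>\<sigma>(y)\<close>. The list may contain repetitions; they act as
  coefficients.\<close>

definition defect_collapses :: "('a, 'm) loop_scheme \<Rightarrow> nat \<Rightarrow> (nat \<Rightarrow> nat lterm) list \<Rightarrow> bool" where
  "defect_collapses L m \<Sigma> \<longleftrightarrow> (\<forall>f s t a\<^sub>1 a\<^sub>2 y.
     set_lterm s \<subseteq> {..<m} \<longrightarrow> set_lterm t \<subseteq> {..<m} \<longrightarrow>
     a\<^sub>1 \<in> carrier L \<longrightarrow> a\<^sub>2 \<in> carrier L \<longrightarrow> (\<forall>i. y i \<in> carrier L) \<longrightarrow>
     defect L f a\<^sub>1 a\<^sub>2 (eval_lterm L y s) (eval_lterm L y t) =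
     loop_product L (map (\<lambda>\<sigma>. defect L f a\<^sub>1 a\<^sub>2 (eval_lterm L (\<lambda>i. eval_lterm L y (\<sigma> i)) s)
                                             (eval_lterm L (\<lambda>i. eval_lterm L y (\<sigma> i)) t)) \<Sigma>))"

lemma defect_collapsesD:
  assumes "defect_collapses L m \<Sigma>" "set_lterm s \<subseteq> {..<m}" "set_lterm t \<subseteq> {..<m}"
    "a\<^sub>1 \<in> carrier L" "a\<^sub>2 \<in> carrier L" "\<And>i. y i \<in> carrier L"
  shows "defect L f a\<^sub>1 a\<^sub>2 (eval_lterm L y s) (eval_lterm L y t) =
     loop_product L (map (\<lambda>\<sigma>. defect L f a\<^sub>1 a\<^sub>2 (eval_lterm L (\<lambda>i. eval_lterm L y (\<sigma> i)) s)
                                             (eval_lterm L (\<lambda>i. eval_lterm L y (\<sigma> i)) t)) \<Sigma>)"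
  using assms unfolding defect_collapses_def by blast

definition central_defects :: "('a, 'm) loop_scheme \<Rightarrow> bool" where
  "central_defects L \<longleftrightarrow> (\<forall>f. \<forall>a\<^sub>1\<in>carrier L. \<forall>a\<^sub>2\<in>carrier L. \<forall>b\<^sub>1\<in>carrier L. \<forall>b\<^sub>2\<in>carrier L.
     defect L f a\<^sub>1 a\<^sub>2 b\<^sub>1 b\<^sub>2 \<in> loop_center L)"

text \<open>Centrality of the defects consists of identities in the four arguments of the defect and two
  further variables.\<close>

lemma central_defects_transfer:
  assumes L: "loop L" "central_defects L"
    and sub: "\<And>s t. set_lterm s \<subseteq> {..<6} \<Longrightarrow> set_lterm t \<subseteq> {..<6} \<Longrightarrow> holds_in L (s, t) \<Longrightarrow> holds_in M (s, t)"
    and M: "loop M"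
  shows "central_defects M"
  unfolding central_defects_def
proof (intro allI ballI)
  fix f a\<^sub>1 a\<^sub>2 b\<^sub>1 b\<^sub>2
  assume abM: "a\<^sub>1 \<in> carrier M" "a\<^sub>2 \<in> carrier M" "b\<^sub>1 \<in> carrier M" "b\<^sub>2 \<in> carrier M"
  interpret M: loop M by fact
  interpret L: loop L by fact
  define d where "d = defect_term f (Var 0) (Var 1) (Var 2) (Var (3::nat))"
  have dc: "eval_lterm L e d \<in> loop_center L" if "\<And>i. e i \<in> carrier L" for e
    using L(2) that by (simp add: d_def central_defects_def)
  have sd: "set_lterm d \<subseteq> {..<6}" by (simp add: d_def)
  have 1: "holds_in M (Mult d (Var 4), Mult (Var 4) d)"
    using sd by (intro sub holds_inI) (auto intro!: L.center_comm dc)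
  have 2: "holds_in M (Mult d (Mult (Var 4) (Var 5)), Mult (Mult d (Var 4)) (Var 5))"
    using sd by (intro sub holds_inI) (auto intro!: L.center_assoc1 dc)
  have 3: "holds_in M (Mult (Var 4) (Mult (Var 5) d), Mult (Mult (Var 4) (Var 5)) d)"
    using sd by (intro sub holds_inI) (auto intro!: L.center_assoc3 dc)
  define e where "e x y = (\<lambda>i. nth [a\<^sub>1, a\<^sub>2, b\<^sub>1, b\<^sub>2, x, y] (if i < 6 then i else 0))" for x y
  have e: "e x y i \<in> carrier M" if "x \<in> carrier M" "y \<in> carrier M" for x y i
    using abM that by (auto simp: e_def nth_Cons split: nat.splits)
  have ev: "eval_lterm M (e x y) d = defect M f a\<^sub>1 a\<^sub>2 b\<^sub>1 b\<^sub>2" for x y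
    by (simp add: d_def e_def)
  have e45: "e x y 4 = x" "e x y 5 = y" for x y by (simp_all add: e_def)
  have "defect M f a\<^sub>1 a\<^sub>2 b\<^sub>1 b\<^sub>2 \<otimes>\<^bsub>M\<^esub> x = x \<otimes>\<^bsub>M\<^esub> defect M f a\<^sub>1 a\<^sub>2 b\<^sub>1 b\<^sub>2" if "x \<in> carrier M" for x
    using holds_inD[OF 1, of "e x x", OF e[OF that that]] by (simp add: ev e45)
  moreover have "defect M f a\<^sub>1 a\<^sub>2 b\<^sub>1 b\<^sub>2 \<otimes>\<^bsub>M\<^esub> (x \<otimes>\<^bsub>M\<^esub> y) = defect M f a\<^sub>1 a\<^sub>2 b\<^sub>1 b\<^sub>2 \<otimes>\<^bsub>M\<^esub> x \<otimes>\<^bsub>M\<^esub> y \<and>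
      x \<otimes>\<^bsub>M\<^esub> (y \<otimes>\<^bsub>M\<^esub> defect M f a\<^sub>1 a\<^sub>2 b\<^sub>1 b\<^sub>2) = x \<otimes>\<^bsub>M\<^esub> y \<otimes>\<^bsub>M\<^esub> defect M f a\<^sub>1 a\<^sub>2 b\<^sub>1 b\<^sub>2"
    if "x \<in> carrier M" "y \<in> carrier M" for x y
    using holds_inD[OF 2, of "e x y", OF e[OF that]] holds_inD[OF 3, of "e x y", OF e[OF that]] by (simp add: ev e45)
  ultimately show "defect M f a\<^sub>1 a\<^sub>2 b\<^sub>1 b\<^sub>2 \<in> loop_center M"
    using M.defect_closed[OF abM] by (simp add: loop_center_def)
qed

text \<open>The block contributes \<open>m\<close> variables, and the elements \<open>a\<^sub>1\<close>, \<open>a\<^sub>2\<close> become the variables with numbers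
  \<open>m\<close> and \<open>m + 1\<close>.\<close>

lemma defect_collapses_transfer:
  fixes L :: "('a, 'm) loop_scheme" and M :: "('b, 'k) loop_scheme"
  assumes L: "loop L" "defect_collapses L m \<Sigma>"
    and \<Sigma>: "\<And>\<sigma>. \<sigma> \<in> set \<Sigma> \<Longrightarrow> degenerate_subst m \<sigma>"
    and sub: "\<And>s t. set_lterm s \<subseteq> {..<m + 2} \<Longrightarrow> set_lterm t \<subseteq> {..<m + 2} \<Longrightarrow> holds_in L (s, t) \<Longrightarrow> holds_in M (s, t)"
    and M: "loop M"
  shows "defect_collapses M m \<Sigma>"
  unfolding defect_collapses_def
proof (intro allI impI)
  fix f s t a\<^sub>1 a\<^sub>2 and y :: "nat \<Rightarrow> _"
  assume s: "set_lterm s \<subseteq> {..<m}" and t: "set_lterm t \<subseteq> {..<m}"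
    and a: "a\<^sub>1 \<in> carrier M" "a\<^sub>2 \<in> carrier M" and y: "\<forall>i. y i \<in> carrier M"
  let ?l = "defect_term f (Var m) (Var (Suc m)) s t"
  let ?r = "product_term (map (\<lambda>\<sigma>. defect_term f (Var m) (Var (Suc m)) (subst_lterm \<sigma> s) (subst_lterm \<sigma> t)) \<Sigma>)"
  have vars: "set_lterm (subst_lterm \<sigma> r) \<subseteq> {..<m}" if "set_lterm r \<subseteq> {..<m}" "\<sigma> \<in> set \<Sigma>" for \<sigma> r
  proof -
    have "set_lterm (\<sigma> v) \<subseteq> {..<m}" if "v \<in> set_lterm r" for v
      using \<Sigma>[OF \<open>\<sigma> \<in> set \<Sigma>\<close>] \<open>set_lterm r \<subseteq> {..<m}\<close> that unfolding degenerate_subst_def by blast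
    then show ?thesis unfolding set_subst by blast
  qed
  have le: "{..<m} \<subseteq> {..<m + 2}" "m \<in> {..<m + 2}" "Suc m \<in> {..<m + 2}" by auto
  have h: "holds_in M (?l, ?r)"
  proof (rule sub)
    have *: "set_lterm (defect_term f (Var m) (Var (Suc m)) s' t') \<subseteq> {..<m + 2}"
      if "set_lterm s' \<subseteq> {..<m}" "set_lterm t' \<subseteq> {..<m}" for s' t'
      using subset_trans[OF that(1) le(1)] subset_trans[OF that(2) le(1)] le(2,3) by simp
    show "set_lterm ?l \<subseteq> {..<m + 2}" by (rule *[OF s t])
    show "set_lterm ?r \<subseteq> {..<m + 2}" unfolding set_product_term set_map UN_simps
      by (intro UN_least *) (rule vars[OF s] vars[OF t], assumption)+
    show "holds_in L (?l, ?r)"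
    proof (rule holds_inI)
      fix e :: "nat \<Rightarrow> 'a" assume e: "\<And>i. e i \<in> carrier L"
      show "eval_lterm L e ?l = eval_lterm L e ?r"
        using defect_collapsesD[where f = f and y = e, OF L(2) s t e[of m] e[of "Suc m"] e]
        by (simp add: eval_product_term o_def eval_subst)
    qed
  qed
  define e where "e i = (if i < m then y i else if i = m then a\<^sub>1 else a\<^sub>2)" for i
  have e: "e i \<in> carrier M" for i using a y by (auto simp: e_def)
  have ea: "e m = a\<^sub>1" "e (Suc m) = a\<^sub>2" by (simp_all add: e_def)
  have *: "eval_lterm M e r = eval_lterm M y r" if "set_lterm r \<subseteq> {..<m}" for r
    using that by (intro eval_cong) (auto simp: e_def)
  have "defect M f (e m) (e (Suc m)) (eval_lterm M e s) (eval_lterm M e t) =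
     loop_product M (map (\<lambda>\<sigma>. defect M f (e m) (e (Suc m)) (eval_lterm M e (subst_lterm \<sigma> s)) (eval_lterm M e (subst_lterm \<sigma> t))) \<Sigma>)"
    using holds_inD[OF h, of e, OF e] by (simp add: eval_product_term o_def)
  also have "map (\<lambda>\<sigma>. defect M f (e m) (e (Suc m)) (eval_lterm M e (subst_lterm \<sigma> s)) (eval_lterm M e (subst_lterm \<sigma> t))) \<Sigma>
     = map (\<lambda>\<sigma>. defect M f a\<^sub>1 a\<^sub>2 (eval_lterm M y (subst_lterm \<sigma> s)) (eval_lterm M y (subst_lterm \<sigma> t))) \<Sigma>"
    by (intro map_cong HOL.refl) (simp add: *[OF vars[OF s]] *[OF vars[OF t]] ea)
  finally show "defect M f a\<^sub>1 a\<^sub>2 (eval_lterm M y s) (eval_lterm M y t) =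
     loop_product M (map (\<lambda>\<sigma>. defect M f a\<^sub>1 a\<^sub>2 (eval_lterm M (\<lambda>i. eval_lterm M y (\<sigma> i)) s)
                                             (eval_lterm M (\<lambda>i. eval_lterm M y (\<sigma> i)) t)) \<Sigma>)"
    by (simp only: *[OF s] *[OF t] ea eval_subst)
qed

context loop
begin

lemma product_center: "set zs \<subseteq> loop_center L \<Longrightarrow> loop_product L zs \<in> loop_center L"
  by (induction zs) (auto simp: one_center center_mult)

text \<open>On the center every operation is a homomorphism, so it commutes with finite products.\<close>

lemma product_op:
  assumes "\<And>x. x \<in> set xs \<Longrightarrow> z x \<in> loop_center L" "\<And>x. x \<in> set xs \<Longrightarrow> w x \<in> loop_center L"
  shows "loop_product L (map (\<lambda>x. apply_op L f (z x) (w x)) xs) =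
    apply_op L f (loop_product L (map z xs)) (loop_product L (map w xs))"
  using assms
proof (induction xs)
  case (Cons x xs)
  have "loop_product L (map z xs) \<in> loop_center L" "loop_product L (map w xs) \<in> loop_center L"
    using Cons by (auto intro!: product_center)
  then show ?case using Cons by (simp add: op_center_interchange center_closed)
qed (simp add: op_one)

lemma product_mult:
  assumes "\<And>x. x \<in> set xs \<Longrightarrow> z x \<in> loop_center L" "\<And>x. x \<in> set xs \<Longrightarrow> w x \<in> loop_center L"
  shows "loop_product L (map (\<lambda>x. z x \<otimes> w x) xs) = loop_product L (map z xs) \<otimes> loop_product L (map w xs)"
  using product_op[OF assms, where f = Times] by simp

end

text \<open>The variables below \<open>m\<close> form the block. In the outer part the block is set to the unit; in the inner
  part all other variables are.\<close>

definition outer_part :: "('a, 'm) loop_scheme \<Rightarrow> nat \<Rightarrow> (nat \<Rightarrow> 'a) \<Rightarrow> nat lterm \<Rightarrow> 'a" where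
  "outer_part L m e t = eval_lterm L (\<lambda>i. if i < m then \<one>\<^bsub>L\<^esub> else e i) t"

definition inner_part :: "('a, 'm) loop_scheme \<Rightarrow> nat \<Rightarrow> (nat \<Rightarrow> 'a) \<Rightarrow> nat lterm \<Rightarrow> 'a" where
  "inner_part L m e t = eval_lterm L (\<lambda>i. if i < m then e i else \<one>\<^bsub>L\<^esub>) t"

definition mixed_part :: "('a, 'm) loop_scheme \<Rightarrow> nat \<Rightarrow> (nat \<Rightarrow> 'a) \<Rightarrow> nat lterm \<Rightarrow> 'a" where
  "mixed_part L m e t = rdiv L (eval_lterm L e t) (outer_part L m e t \<otimes>\<^bsub>L\<^esub> inner_part L m e t)"

definition subst_block :: "('a, 'm) loop_scheme \<Rightarrow> nat \<Rightarrow> (nat \<Rightarrow> nat lterm) \<Rightarrow> (nat \<Rightarrow> 'a) \<Rightarrow> nat \<Rightarrow> 'a" where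
  "subst_block L m \<sigma> e = (\<lambda>i. if i < m then eval_lterm L e (\<sigma> i) else e i)"

context loop
begin

lemma parts_closed:
  assumes "\<And>i. e i \<in> carrier L"
  shows "outer_part L m e t \<in> carrier L" "inner_part L m e t \<in> carrier L"
  using assms one_closed by (auto simp: outer_part_def inner_part_def intro!: eval_closed)

text \<open>Writing both arguments as outer part times inner part times a central mixed part, the central factors
  can be pulled out of the operation, and what remains is corrected by the defect.\<close>

lemma mixed_part_op:
  assumes cd: "central_defects L" and e: "\<And>i. e i \<in> carrier L"
    and c: "mixed_part L m e s \<in> loop_center L" "mixed_part L m e t \<in> loop_center L"
  shows "mixed_part L m e (term_op f s t) =
    defect L f (outer_part L m e s) (outer_part L m e t) (inner_part L m e s) (inner_part L m e t) \<otimes>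
      apply_op L f (mixed_part L m e s) (mixed_part L m e t)"
proof -
  let ?A = "outer_part L m e" and ?B = "inner_part L m e" and ?z = "mixed_part L m e"
  let ?d = "defect L f (?A s) (?A t) (?B s) (?B t)"
  note AB = parts_closed[of e, OF e, of m]
  have d: "?d \<in> loop_center L" using cd AB by (simp add: central_defects_def)
  have w: "apply_op L f (?z s) (?z t) \<in> loop_center L" using c by (rule center_op)
  have ev: "eval_lterm L e r = (?A r \<otimes> ?B r) \<otimes> ?z r" if "?z r \<in> loop_center L" for r
  proof -
    have "?z r \<otimes> (?A r \<otimes> ?B r) = eval_lterm L e r"
      unfolding mixed_part_def using AB eval_closed[of e, OF e] by (simp add: mult_rdiv m_closed)
    then show ?thesis using center_comm[OF that, of "?A r \<otimes> ?B r"] AB by (simp add: m_closed)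
  qed
  let ?u = "apply_op L f (?A s) (?A t) \<otimes> apply_op L f (?B s) (?B t)"
  have u: "?u \<in> carrier L" using AB by (simp add: m_closed op_closed)
  have "eval_lterm L e (term_op f s t) = apply_op L f (?A s \<otimes> ?B s) (?A t \<otimes> ?B t) \<otimes> apply_op L f (?z s) (?z t)"
    using c AB by (simp add: ev op_center_interchange m_closed)
  also have "\<dots> = (?d \<otimes> ?u) \<otimes> apply_op L f (?z s) (?z t)"
    using AB by (simp add: defect_mult)
  also have "\<dots> = (?d \<otimes> apply_op L f (?z s) (?z t)) \<otimes> ?u"
    using d w u center_assoc1 center_assoc3 center_comm center_closed m_closed by metis
  also have "?u = ?A (term_op f s t) \<otimes> ?B (term_op f s t)"
    by (simp add: outer_part_def inner_part_def)
  finally show ?thesis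
    unfolding mixed_part_def[of L m e "term_op f s t"] using AB center_closed[OF center_mult[OF d w]]
    by (intro rdiv_eqI) (auto intro!: m_closed)
qed

lemma mixed_part_center:
  assumes cd: "central_defects L" and e: "\<And>i. e i \<in> carrier L"
  shows "mixed_part L m e t \<in> loop_center L"
proof (induction t rule: lterm_op_induct)
  case (Op f s t)
  then show ?case
    using cd parts_closed[of e, OF e] by (subst mixed_part_op[OF cd e])
      (auto intro!: center_mult center_op simp: central_defects_def)
next
  case (Var v)
  have "mixed_part L m e (Var v) = \<one>"
    using e by (auto simp: mixed_part_def outer_part_def inner_part_def r_one l_one one_closed intro!: rdiv_eqI)
  then show ?case by (simp add: one_center)
next
  case One
  have "mixed_part L m e One = \<one>"
    by (auto simp: mixed_part_def outer_part_def inner_part_def r_one l_one one_closed intro!: rdiv_eqI)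
  then show ?case by (simp add: one_center)
qed

text \<open>A substitution into the block leaves the outer parts unchanged, and the inner parts are terms in the
  block only. So the collapse of the defects propagates through the recursion for mixed parts.\<close>

lemma mixed_part_collapse:
  assumes cd: "central_defects L" and dc: "defect_collapses L m \<Sigma>"
    and \<Sigma>: "\<And>\<sigma>. \<sigma> \<in> set \<Sigma> \<Longrightarrow> degenerate_subst m \<sigma>" and e: "\<And>i. e i \<in> carrier L"
  shows "mixed_part L m e t = loop_product L (map (\<lambda>\<sigma>. mixed_part L m (subst_block L m \<sigma> e) t) \<Sigma>)"
proof -
  have sb: "subst_block L m \<sigma> e i \<in> carrier L" for \<sigma> i
    using e by (auto simp: subst_block_def eval_closed)
  have prod_one: "loop_product L (map (\<lambda>\<sigma>. \<one>) \<Sigma>) = \<one>"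
    by (induction \<Sigma>) (auto simp: l_one one_closed)
  have triv: "mixed_part L m e' (Var v) = \<one> \<and> mixed_part L m e' One = \<one>" if "\<And>i. e' i \<in> carrier L" for e' v
    using that by (auto simp: mixed_part_def outer_part_def inner_part_def r_one l_one one_closed intro!: rdiv_eqI)
  show ?thesis
  proof (induction t rule: lterm_op_induct)
    case (Var v)
    then show ?case using triv[of e] triv[OF sb] e prod_one by simp
  next
    case One
    then show ?case using triv[of e] triv[OF sb] e prod_one by simp
  next
    case (Op f s t)
    let ?z = "mixed_part L m" and ?A = "outer_part L m" and ?B = "inner_part L m" and ?e = "\<lambda>\<sigma>. subst_block L m \<sigma> e"
    have out: "?A (?e \<sigma>) r = ?A e r" for \<sigma> r
      by (auto simp: outer_part_def subst_block_def intro!: eval_cong)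
    \<comment> \<open>Inner parts are values of the term \<open>tr r\<close> in the block variables alone.\<close>
    define tr where "tr r = subst_lterm (\<lambda>i. if i < m then Var i else One) r" for r :: "nat lterm"
    have tr: "set_lterm (tr r) \<subseteq> {..<m}" for r
      by (auto simp: tr_def set_subst split: if_splits)
    have inn0: "?B e' r = eval_lterm L e' (tr r)" for e' r
      by (auto simp: inner_part_def tr_def eval_subst intro!: eval_cong)
    have inn: "?B (?e \<sigma>) r = eval_lterm L (\<lambda>i. eval_lterm L e (\<sigma> i)) (tr r)" for \<sigma> r
      unfolding inn0 using tr[of r] by (intro eval_cong) (auto simp: subst_block_def)
    have A: "?A e s \<in> carrier L" "?A e t \<in> carrier L" using parts_closed[of e, OF e] by auto
    have D: "defect L f (?A e s) (?A e t) (?B e s) (?B e t) =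
        loop_product L (map (\<lambda>\<sigma>. defect L f (?A (?e \<sigma>) s) (?A (?e \<sigma>) t) (?B (?e \<sigma>) s) (?B (?e \<sigma>) t)) \<Sigma>)"
      using defect_collapsesD[where f = f and y = e, OF dc tr[of s] tr[of t] A e]
      by (simp only: inn inn0[of e] out)
    have "?z e (term_op f s t) = loop_product L (map (\<lambda>\<sigma>. defect L f (?A (?e \<sigma>) s) (?A (?e \<sigma>) t) (?B (?e \<sigma>) s) (?B (?e \<sigma>) t)) \<Sigma>)
        \<otimes> apply_op L f (loop_product L (map (\<lambda>\<sigma>. ?z (?e \<sigma>) s) \<Sigma>)) (loop_product L (map (\<lambda>\<sigma>. ?z (?e \<sigma>) t) \<Sigma>))"
      using mixed_part_op[where e = e and m = m and f = f and s = s and t = t, OF cd e mixed_part_center[OF cd e] mixed_part_center[OF cd e]]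
      by (simp only: D Op.IH)
    also have "apply_op L f (loop_product L (map (\<lambda>\<sigma>. ?z (?e \<sigma>) s) \<Sigma>)) (loop_product L (map (\<lambda>\<sigma>. ?z (?e \<sigma>) t) \<Sigma>))
        = loop_product L (map (\<lambda>\<sigma>. apply_op L f (?z (?e \<sigma>) s) (?z (?e \<sigma>) t)) \<Sigma>)"
      by (intro product_op[symmetric] mixed_part_center cd sb)
    also have "loop_product L (map (\<lambda>\<sigma>. defect L f (?A (?e \<sigma>) s) (?A (?e \<sigma>) t) (?B (?e \<sigma>) s) (?B (?e \<sigma>) t)) \<Sigma>) \<otimes> \<dots>
        = loop_product L (map (\<lambda>\<sigma>. defect L f (?A (?e \<sigma>) s) (?A (?e \<sigma>) t) (?B (?e \<sigma>) s) (?B (?e \<sigma>) t) \<otimes>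
             apply_op L f (?z (?e \<sigma>) s) (?z (?e \<sigma>) t)) \<Sigma>)"
      using cd parts_closed[OF sb]
      by (intro product_mult[symmetric]) (auto intro!: center_op mixed_part_center[OF cd] sb simp: central_defects_def)
    also have "\<dots> = loop_product L (map (\<lambda>\<sigma>. ?z (?e \<sigma>) (term_op f s t)) \<Sigma>)"
      by (simp add: mixed_part_op[OF cd sb mixed_part_center[OF cd sb] mixed_part_center[OF cd sb]])
    finally show ?case .
  qed
qed

end

text \<open>Induction on the number of variables of an identity \<open>t = 1\<close>. When there are more than \<open>m + 6\<close> of
  them, the mixed part of \<open>t\<close> is a product of mixed parts that involve only consequences of \<open>t = 1\<close>
  with fewer variables.\<close>

lemma identities_bounded_variables:
  fixes L :: "('a, 'm) loop_scheme" and M :: "('b, 'k) loop_scheme"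
  assumes L: "loop L" "central_defects L" "defect_collapses L m \<Sigma>"
    and \<Sigma>: "\<And>\<sigma>. \<sigma> \<in> set \<Sigma> \<Longrightarrow> degenerate_subst m \<sigma>" and m: "0 < m"
    and M: "loop M"
    and sub: "\<And>s t. set_lterm s \<subseteq> {..<m + 6} \<Longrightarrow> set_lterm t \<subseteq> {..<m + 6} \<Longrightarrow> holds_in L (s, t) \<Longrightarrow> holds_in M (s, t)"
    and st: "holds_in L (s, t)"
  shows "holds_in M (s, t)"
proof -
  interpret L: loop L by fact
  interpret M: loop M by fact
  have sub6: "holds_in M (s, t)" if "set_lterm s \<subseteq> {..<6}" "set_lterm t \<subseteq> {..<6}" "holds_in L (s, t)" for s t
    using that by (intro sub) (auto dest: subsetD)
  have sub2: "holds_in M (s, t)" if "set_lterm s \<subseteq> {..<m + 2}" "set_lterm t \<subseteq> {..<m + 2}" "holds_in L (s, t)" for s t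
    using that by (intro sub) (fastforce dest: subsetD)+
  have cdM: "central_defects M" using central_defects_transfer[OF L(1,2) sub6 M] by blast
  have dcM: "defect_collapses M m \<Sigma>" using defect_collapses_transfer[OF L(1,3) \<Sigma> sub2 M] by blast
  have holds_subst: "holds_in K (subst_lterm \<sigma> t, One)" if "loop K" "holds_in K (t, One)" for K :: "('c, 'd) loop_scheme" and \<sigma> t
  proof -
    interpret K: loop K by fact
    show ?thesis
    proof (rule holds_inI)
      fix e :: "nat \<Rightarrow> 'c" assume "\<And>i. e i \<in> carrier K"
      then show "eval_lterm K e (subst_lterm \<sigma> t) = eval_lterm K e One"
        using holds_inD[OF that(2) K.eval_closed[of e]] by (simp add: eval_subst)
    qed
  qed
  have main: "holds_in M (t, One)" if "holds_in L (t, One)" for t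
    using that
  proof (induction "card (set_lterm t)" arbitrary: t rule: less_induct)
    case less
    define n where "n = card (set_lterm t)"
    \<comment> \<open>Renaming makes the variables \<open>0, ..., n - 1\<close>, so that the first \<open>m\<close> of them can serve as the block.\<close>
    obtain \<pi> where \<pi>: "bij_betw \<pi> (set_lterm t) {..<n}"
      using ex_bij_betw_finite_nat[OF finite_set_lterm, of t] by (auto simp: n_def atLeast0LessThan)
    define t' where "t' = subst_lterm (\<lambda>v. Var (\<pi> v)) t"
    have t't: "t = subst_lterm (\<lambda>v. Var (inv_into (set_lterm t) \<pi> v)) t'"
    proof -
      have "subst_lterm (\<lambda>v. Var (inv_into (set_lterm t) \<pi> v)) t' = subst_lterm (\<lambda>v. Var (inv_into (set_lterm t) \<pi> (\<pi> v))) t"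
        by (simp add: t'_def subst_subst)
      also have "\<dots> = subst_lterm Var t"
        using \<pi>
        by (intro subst_cong) (auto simp: bij_betw_def)
      finally show ?thesis by simp
    qed
    have Lt': "holds_in L (t', One)" unfolding t'_def by (rule holds_subst[OF L(1) less.prems])
    have st': "set_lterm t' = {..<n}" using \<pi> by (auto simp: t'_def set_subst bij_betw_def)
    have "holds_in M (t', One)"
    proof (cases "n \<le> m + 6")
      case True
      then show ?thesis using st' Lt' by (intro sub) auto
    next
      case False
      then have nm: "m + 6 < n" by simp
      have IH: "holds_in M (u, One)" if "holds_in L (u, One)" "set_lterm u \<subseteq> A" "A \<subset> {..<n}" for u A
      proof (rule less.hyps)
        have "card (set_lterm u) < card {..<n}" using that by (intro psubset_card_mono) auto
        then show "card (set_lterm u) < card (set_lterm t)" by (simp add: n_def)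
      qed (fact that)
      have "0 \<in> {..<n}" "0 \<notin> {m..<n}" "{m..<n} \<subseteq> {..<n}" using m nm by (simp_all add: subset_iff)
      then have sub_out: "{m..<n} \<subset> {..<n}" by blast
      have "m \<in> {..<n}" "m \<notin> {..<m}" "{..<m} \<subseteq> {..<n}" using nm by (simp_all add: subset_iff)
      then have sub_in: "{..<m} \<subset> {..<n}" by blast
      have "set_lterm (subst_lterm (\<lambda>i. if i < m then One else Var i) t') \<subseteq> {m..<n}"
        unfolding set_subst st' by (auto split: if_splits)
      then have hout: "holds_in M (subst_lterm (\<lambda>i. if i < m then One else Var i) t', One)"
        by (rule IH[OF holds_subst[OF L(1) Lt'] _ sub_out])
      have "set_lterm (subst_lterm (\<lambda>i. if i < m then Var i else One) t') \<subseteq> {..<m}"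
        unfolding set_subst st' by (auto split: if_splits)
      then have hin: "holds_in M (subst_lterm (\<lambda>i. if i < m then Var i else One) t', One)"
        by (rule IH[OF holds_subst[OF L(1) Lt'] _ sub_in])
      show ?thesis
      proof (rule holds_inI)
        fix e :: "nat \<Rightarrow> 'b" assume e: "\<And>i. e i \<in> carrier M"
        have out1: "outer_part M m e' t' = \<one>\<^bsub>M\<^esub>" if "\<And>i. e' i \<in> carrier M" for e'
        proof -
          have "outer_part M m e' t' = eval_lterm M e' (subst_lterm (\<lambda>i. if i < m then One else Var i) t')"
            by (auto simp: outer_part_def eval_subst intro!: eval_cong)
          then show ?thesis using holds_inD[OF hout that] by simp
        qed
        have in1: "inner_part M m e' t' = \<one>\<^bsub>M\<^esub>" if "\<And>i. e' i \<in> carrier M" for e'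
        proof -
          have "inner_part M m e' t' = eval_lterm M e' (subst_lterm (\<lambda>i. if i < m then Var i else One) t')"
            by (auto simp: inner_part_def eval_subst intro!: eval_cong)
          then show ?thesis using holds_inD[OF hin that] by simp
        qed
        have mix1: "mixed_part M m (subst_block M m \<sigma> e) t' = \<one>\<^bsub>M\<^esub>" if \<sigma>: "\<sigma> \<in> set \<Sigma>" for \<sigma>
        proof -
          have sb: "subst_block M m \<sigma> e i \<in> carrier M" for i
            using e by (auto simp: subst_block_def M.eval_closed)
          obtain P Q where PQ: "\<And>i. i < m \<Longrightarrow> \<sigma> i = subst_lterm Q (P i)" "(\<Union>i<m. set_lterm (P i)) \<subset> {..<m}"
            using \<Sigma>[OF \<sigma>] by (auto simp: degenerate_subst_def)
          define S where "S = (\<Union>i<m. set_lterm (P i))"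
          \<comment> \<open>The value of \<open>t'\<close> at the degenerate point is a value of \<open>u\<close>, which has fewer variables.\<close>
          define u where "u = subst_lterm (\<lambda>i. if i < m then P i else Var i) t'"
          have hu: "holds_in M (u, One)"
          proof (rule IH[of _ "S \<union> {m..<n}"])
            show "holds_in L (u, One)" unfolding u_def by (rule holds_subst[OF L(1) Lt'])
            show "set_lterm u \<subseteq> S \<union> {m..<n}"
              using st' by (auto simp: u_def set_subst S_def split: if_splits)
            obtain j where j: "j < m" "j \<notin> S" "S \<subseteq> {..<m}" using PQ(2) unfolding S_def by blast
            then have "j \<in> {..<n}" "j \<notin> S \<union> {m..<n}" "S \<union> {m..<n} \<subseteq> {..<n}"
              using nm by (auto dest: subsetD)
            then show "S \<union> {m..<n} \<subset> {..<n}" by blast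
          qed
          define e' where "e' v = (if v < m then eval_lterm M e (Q v) else e v)" for v
          have e': "e' v \<in> carrier M" for v using e by (auto simp: e'_def M.eval_closed)
          have "eval_lterm M (subst_block M m \<sigma> e) t' = eval_lterm M e' u"
            unfolding u_def eval_subst
          proof (rule eval_cong)
            fix i
            show "subst_block M m \<sigma> e i = eval_lterm M e' (if i < m then P i else Var i)"
            proof (cases "i < m")
              case True
              then have "set_lterm (P i) \<subseteq> {..<m}" using PQ(2) by blast
              then have "eval_lterm M e' (P i) = eval_lterm M (\<lambda>v. eval_lterm M e (Q v)) (P i)"
                by (intro eval_cong) (auto simp: e'_def)
              then show ?thesis using True PQ(1) by (simp add: subst_block_def eval_subst)
            qed (simp add: subst_block_def e'_def)
          qed
          also have "\<dots> = \<one>\<^bsub>M\<^esub>" using holds_inD[OF hu, of e', OF e'] by simp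
          finally show ?thesis
            using out1[of "subst_block M m \<sigma> e", OF sb] in1[of "subst_block M m \<sigma> e", OF sb]
            by (auto simp: mixed_part_def M.one_closed M.l_one intro!: M.rdiv_eqI)
        qed
        have "mixed_part M m e t' = loop_product M (map (\<lambda>\<sigma>. \<one>\<^bsub>M\<^esub>) \<Sigma>)"
          using M.mixed_part_collapse[where e = e and t = t', OF cdM dcM \<Sigma> e] mix1 by (simp cong: map_cong)
        also have "\<dots> = \<one>\<^bsub>M\<^esub>" by (induction \<Sigma>) (auto simp: M.l_one M.one_closed)
        finally have "eval_lterm M e t' = \<one>\<^bsub>M\<^esub>"
          using out1[of e, OF e] in1[of e, OF e] M.eval_closed[of e t', OF e]
          by (simp add: mixed_part_def M.one_closed M.l_one M.rdiv_eq_one_iff)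
        then show "eval_lterm M e t' = eval_lterm M e One" by simp
      qed
    qed
    from holds_subst[OF M this, of "\<lambda>v. Var (inv_into (set_lterm t) \<pi> v)"]
    show ?case by (simp only: t't[symmetric])
  qed
  have "holds_in L (RDiv s t, One)"
  proof (rule holds_inI)
    fix e :: "nat \<Rightarrow> 'a" assume e: "\<And>i. e i \<in> carrier L"
    show "eval_lterm L e (RDiv s t) = eval_lterm L e One"
      using holds_inD[OF st, of e, OF e] L.eval_closed[of e, OF e] by (simp add: L.rdiv_eq_one_iff)
  qed
  then have h: "holds_in M (RDiv s t, One)" by (rule main)
  show ?thesis
  proof (rule holds_inI)
    fix e :: "nat \<Rightarrow> 'b" assume e: "\<And>i. e i \<in> carrier M"
    show "eval_lterm M e s = eval_lterm M e t"
      using holds_inD[OF h, of e, OF e] M.eval_closed[of e, OF e] by (simp add: M.rdiv_eq_one_iff)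
  qed
qed

section \<open>Nilpotent loops of order pq as central extensions\<close>

text \<open>A group of prime order is generated by any nontrivial element. Discrete logarithms with values in the
  integers make it possible to compute with congruences instead of a quotient type.\<close>

lemma (in group) prime_order_discrete_log:
  assumes "prime (order G)"
  obtains \<delta> :: "'a \<Rightarrow> int" where
    "\<And>x y. x \<in> carrier G \<Longrightarrow> y \<in> carrier G \<Longrightarrow> [\<delta> (x \<otimes> y) = \<delta> x + \<delta> y] (mod int (order G))"
    "\<And>x y. x \<in> carrier G \<Longrightarrow> y \<in> carrier G \<Longrightarrow> [\<delta> x = \<delta> y] (mod int (order G)) \<Longrightarrow> x = y"
proof -
  have fin: "finite (carrier G)" and "order G > 1"
    using assms prime_gt_1_nat[OF assms] by (auto simp: order_def intro: card_ge_0_finite)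
  then have "carrier G \<noteq> {\<one>}" by (auto simp: order_def)
  then obtain g where g: "g \<in> carrier G" "g \<noteq> \<one>" by auto
  have "ord g = 1 \<or> ord g = order G" using ord_dvd_group_order[OF g(1)] assms by (auto simp: prime_nat_iff)
  then have ord: "ord g = order G" using ord_eq_1 g by auto
  have "generate G {g} = carrier G"
    using generate_pow_card[OF g(1)] generate_in_carrier[of "{g}"] g fin ord
    by (intro card_subset_eq) (auto simp: order_def)
  then have gen: "\<exists>k. x = g [^] (k::int)" if "x \<in> carrier G" for x
    using that generate_pow[OF g(1)] by auto
  define \<delta> where "\<delta> x = (SOME k. x = g [^] (k::int))" for x
  have \<delta>: "x = g [^] \<delta> x" if "x \<in> carrier G" for x
    unfolding \<delta>_def by (rule someI_ex) (rule gen[OF that])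
  have pow_eq: "g [^] m = g [^] n \<longleftrightarrow> [m = n] (mod int (order G))" for m n :: int
    using int_pow_eq[OF g(1), of n m] ord by (metis cong_iff_dvd_diff)
  show ?thesis
  proof (rule that)
    fix x y assume xy: "x \<in> carrier G" "y \<in> carrier G"
    have "g [^] \<delta> (x \<otimes> y) = g [^] (\<delta> x + \<delta> y)"
      using \<delta>[of "x \<otimes> y"] \<delta>[OF xy(1)] \<delta>[OF xy(2)] xy int_pow_mult[OF g(1)] by simp
    then show "[\<delta> (x \<otimes> y) = \<delta> x + \<delta> y] (mod int (order G))" by (simp only: pow_eq)
    show "x = y" if "[\<delta> x = \<delta> y] (mod int (order G))"
      using that \<delta>[OF xy(1)] \<delta>[OF xy(2)] pow_eq by metis
  qed
qed

definition center_relation :: "('a, 'm) loop_scheme \<Rightarrow> 'a rel" where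
  "center_relation L = {(x, x \<otimes>\<^bsub>L\<^esub> z) |x z. x \<in> carrier L \<and> z \<in> loop_center L}"

context loop
begin

lemma center_group: "comm_group (L\<lparr>carrier := loop_center L\<rparr>)"
proof (rule comm_groupI)
  fix x assume x: "x \<in> carrier (L\<lparr>carrier := loop_center L\<rparr>)"
  then have "ldiv L x \<one> \<otimes> x = \<one>"
    using center_comm[OF center_inverse[of x], of x] by (simp add: center_closed mult_ldiv one_closed)
  then show "\<exists>y\<in>carrier (L\<lparr>carrier := loop_center L\<rparr>). y \<otimes>\<^bsub>L\<lparr>carrier := loop_center L\<rparr>\<^esub> x = \<one>\<^bsub>L\<lparr>carrier := loop_center L\<rparr>\<^esub>"
    using x center_inverse by auto
qed (auto simp: center_mult one_center center_closed l_one intro: center_comm center_assoc1[symmetric])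

lemma center_cancel:
  assumes x: "x \<in> carrier L" and z: "z \<in> loop_center L"
  shows "(x \<otimes> z) \<otimes> ldiv L z \<one> = x"
proof -
  have "(x \<otimes> z) \<otimes> ldiv L z \<one> = x \<otimes> (z \<otimes> ldiv L z \<one>)"
    by (rule center_assoc3[OF center_inverse[OF z] x center_closed[OF z], symmetric])
  then show ?thesis using x z by (simp add: center_closed mult_ldiv one_closed r_one)
qed

lemma center_relation_equiv: "equiv (carrier L) (center_relation L)"
proof (rule equivI)
  show "center_relation L \<subseteq> carrier L \<times> carrier L"
    by (auto simp: center_relation_def m_closed center_closed)
  show "refl_on (carrier L) (center_relation L)"
    by (rule refl_onI) (auto simp: center_relation_def r_one one_center intro!: exI[of _ \<one>])
  show "sym_on UNIV (center_relation L)"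
  proof (rule symI)
    fix x y assume "(x, y) \<in> center_relation L"
    then obtain z where z: "x \<in> carrier L" "z \<in> loop_center L" "y = x \<otimes> z" by (auto simp: center_relation_def)
    then have "x = y \<otimes> ldiv L z \<one>" "y \<in> carrier L" by (auto simp: center_cancel m_closed center_closed)
    then show "(y, x) \<in> center_relation L" using center_inverse[OF z(2)] by (auto simp: center_relation_def)
  qed
  show "trans_on UNIV (center_relation L)"
  proof (rule transI)
    fix x y w assume "(x, y) \<in> center_relation L" "(y, w) \<in> center_relation L"
    then obtain z z' where z: "x \<in> carrier L" "z \<in> loop_center L" "y = x \<otimes> z" "z' \<in> loop_center L" "w = y \<otimes> z'"
      by (auto simp: center_relation_def)
    then have "w = x \<otimes> (z \<otimes> z')" by (simp add: center_assoc3 center_closed)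
    then show "(x, w) \<in> center_relation L" using z center_mult by (auto simp: center_relation_def)
  qed
qed

lemma center_relation_congruence: "loop_congruence L (center_relation L)"
proof (rule loop_congruenceI[OF center_relation_equiv])
  fix f x x' y y' assume "(x, x') \<in> center_relation L" "(y, y') \<in> center_relation L"
  then obtain z w where *: "x \<in> carrier L" "z \<in> loop_center L" "x' = x \<otimes> z"
      "y \<in> carrier L" "w \<in> loop_center L" "y' = y \<otimes> w"
    by (auto simp: center_relation_def)
  then have "apply_op L f x' y' = apply_op L f x y \<otimes> apply_op L f z w" by (simp add: op_center_interchange)
  then show "(apply_op L f x y, apply_op L f x' y') \<in> center_relation L"
    using * by (auto simp: center_relation_def op_closed center_op)
qed

lemma card_center_class: "x \<in> carrier L \<Longrightarrow> card (center_relation L `` {x}) = card (loop_center L)"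
proof -
  assume x: "x \<in> carrier L"
  have "center_relation L `` {x} = (\<lambda>z. x \<otimes> z) ` loop_center L" using x by (auto simp: center_relation_def)
  moreover have "inj_on (\<lambda>z. x \<otimes> z) (loop_center L)"
    using x by (auto intro!: inj_onI dest!: l_cancel simp: center_closed)
  ultimately show ?thesis by (simp add: card_image)
qed

lemma order_center_quotient:
  assumes "finite (carrier L)"
  shows "order L = card (loop_center L) * order (loop_quotient L (center_relation L))"
proof -
  let ?Q = "carrier L // center_relation L"
  have U: "\<Union>?Q = carrier L" using center_relation_equiv by (rule Union_quotient)
  have "finite ?Q" using assms center_relation_equiv
    by (intro finite_quotient) (auto simp: equiv_def)
  moreover have "card X = card (loop_center L)" if "X \<in> ?Q" for X
    using that by (auto simp: card_center_class elim!: quotientE)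
  moreover have "X \<inter> Y = {}" if "X \<in> ?Q" "Y \<in> ?Q" "X \<noteq> Y" for X Y
    using quotient_disj[OF center_relation_equiv] that by blast
  ultimately have "card (loop_center L) * card ?Q = card (\<Union>?Q)"
    using U assms by (intro card_partition) simp_all
  then show ?thesis using U by (simp add: order_def loop_quotient_def)
qed

lemma abelian_if_center:
  assumes "loop_center L = carrier L"
  shows "comm_group L"
proof -
  have "L\<lparr>carrier := carrier L\<rparr> = L" by simp
  then show ?thesis using center_group unfolding assms by simp
qed

end

text \<open>Each condition defining the center can be written as the equation \<open>f(a, 1) = f(a, y)\<close> for a polynomial
  \<open>f\<close> with \<open>f(1, y) = 1\<close> for all \<open>y\<close>. The term condition moves the equation
  \<open>f(1, 1) = f(1, y)\<close> from \<open>1\<close> to any \<open>a\<close> congruent to it. The image \<open>\<pi>\<close> allows the commutator to be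
  nontrivial in \<open>L\<close> itself.\<close>

lemma (in loop) commutator_central_image:
  assumes Q: "loop Q"
    and surj: "\<pi> ` carrier L = carrier Q"
    and one: "\<pi> \<one>\<^bsub>L\<^esub> = \<one>\<^bsub>Q\<^esub>"
    and hom: "\<And>f x y. x \<in> carrier L \<Longrightarrow> y \<in> carrier L \<Longrightarrow> \<pi> (apply_op L f x y) = apply_op Q f (\<pi> x) (\<pi> y)"
    and \<alpha>: "loop_congruence L \<alpha>"
    and comm: "\<And>x y. (x, y) \<in> commutator L \<alpha> (total_congruence L) \<Longrightarrow> \<pi> x = \<pi> y"
    and a: "(\<one>\<^bsub>L\<^esub>, a) \<in> \<alpha>"
  shows "\<pi> a \<in> loop_center Q"
proof -
  interpret Q: loop Q by fact
  let ?\<delta> = "commutator L \<alpha> (total_congruence L)"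
  have ac: "a \<in> carrier L" using a \<alpha> by (auto simp: loop_congruence_def equiv_def refl_on_def)
  have tc: "term_condition L \<alpha> (total_congruence L) ?\<delta>" and \<delta>: "loop_congruence L ?\<delta>"
    using commutator_least[OF \<alpha> loop_congruence_total] by auto
  \<comment> \<open>A polynomial that is constant at \<open>1\<close> is constant at \<open>a\<close> modulo the commutator.\<close>
  have key: "\<pi> (eval_poly L f (\<lambda>i. a) (\<lambda>i. \<one>)) = \<pi> (eval_poly L f (\<lambda>i. a) d)"
    if f: "set_lterm f \<subseteq> {PX 0, PY 0, PY 1}" and d: "\<And>i. d i \<in> carrier L"
      and const: "\<And>c. (\<And>i. c i \<in> carrier L) \<Longrightarrow> eval_poly L f (\<lambda>i. \<one>) c = \<one>" for f d
  proof (rule comm)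
    have "f \<in> loop_polys L" using f by (auto simp: loop_polys_def)
    moreover have "(eval_poly L f (\<lambda>i. \<one>) (\<lambda>i. \<one>), eval_poly L f (\<lambda>i. \<one>) d) \<in> ?\<delta>"
      using const[of d] const[of "\<lambda>i. \<one>"] d one_closed congruence_refl[OF \<delta>] by simp
    ultimately show "(eval_poly L f (\<lambda>i. a) (\<lambda>i. \<one>), eval_poly L f (\<lambda>i. a) d) \<in> ?\<delta>"
      using tc[unfolded term_condition_def, rule_format, of f "\<lambda>i. \<one>" "\<lambda>i. a" "\<lambda>i. \<one>" d] a d one_closed
      by auto
  qed
  note h = hom[of _ _ Times, simplified] hom[of _ _ Under, simplified] hom[of _ _ Over, simplified]
  let ?X = "Var (PX 0) :: 'a loop_poly" and ?Y = "Var (PY 0) :: 'a loop_poly" and ?W = "Var (PY 1) :: 'a loop_poly"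
  define d where "d y w = (\<lambda>i::nat. if i = 0 then y else w)" for y w :: 'a
  have d: "d y w i \<in> carrier L" if "y \<in> carrier L" "w \<in> carrier L" for y w i using that by (simp add: d_def)
  have d01: "d y w 0 = y" "d y w 1 = w" "d y w (Suc 0) = w" for y w by (simp_all add: d_def)
  note cl = m_closed ldiv_closed rdiv_closed one_closed
  note laws = r_one l_one ldiv_mult mult_ldiv rdiv_mult mult_rdiv
  note Qlaws = Q.r_one Q.l_one Q.ldiv_mult Q.mult_ldiv Q.rdiv_mult Q.mult_rdiv
  have \<pi>c: "\<pi> x \<in> carrier Q" if "x \<in> carrier L" for x using that surj by auto
  have ldiv1: "ldiv L x x = \<one>" "rdiv L x x = \<one>" if "x \<in> carrier L" for x
    using that by (auto intro!: ldiv_eqI rdiv_eqI simp: laws cl)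
  have ldivQ: "ldiv L \<one> x = x" "rdiv L x \<one> = x" if "x \<in> carrier L" for x
    using that by (auto intro!: ldiv_eqI rdiv_eqI simp: laws cl)
  have c1: "\<pi> a \<otimes>\<^bsub>Q\<^esub> \<pi> y = \<pi> y \<otimes>\<^bsub>Q\<^esub> \<pi> a" if y: "y \<in> carrier L" for y
  proof -
    have "\<pi> (rdiv L (y \<otimes> a) y) = \<pi> a"
      using key[of "RDiv (Mult ?Y ?X) ?Y" "d y y"] y ac d
      by (simp add: eval_poly_def d01 laws cl ldiv1 ldivQ)
    then have "rdiv Q (\<pi> y \<otimes>\<^bsub>Q\<^esub> \<pi> a) (\<pi> y) = \<pi> a" using y ac by (simp add: h cl)
    then show ?thesis using Q.mult_rdiv[of "\<pi> y" "\<pi> y \<otimes>\<^bsub>Q\<^esub> \<pi> a"] y ac \<pi>c by (simp add: Q.m_closed)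
  qed
  have c2: "\<pi> a \<otimes>\<^bsub>Q\<^esub> (\<pi> y \<otimes>\<^bsub>Q\<^esub> \<pi> w) = (\<pi> a \<otimes>\<^bsub>Q\<^esub> \<pi> y) \<otimes>\<^bsub>Q\<^esub> \<pi> w" if y: "y \<in> carrier L" "w \<in> carrier L" for y w
  proof -
    have "\<pi> (rdiv L ((a \<otimes> y) \<otimes> w) (y \<otimes> w)) = \<pi> a"
      using key[of "RDiv (Mult (Mult ?X ?Y) ?W) (Mult ?Y ?W)" "d y w"] y ac d
      by (simp add: eval_poly_def d01 laws cl ldiv1 ldivQ)
    then have "rdiv Q ((\<pi> a \<otimes>\<^bsub>Q\<^esub> \<pi> y) \<otimes>\<^bsub>Q\<^esub> \<pi> w) (\<pi> y \<otimes>\<^bsub>Q\<^esub> \<pi> w) = \<pi> a" using y ac by (simp add: h cl)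
    then show ?thesis using Q.mult_rdiv[of "\<pi> y \<otimes>\<^bsub>Q\<^esub> \<pi> w" "(\<pi> a \<otimes>\<^bsub>Q\<^esub> \<pi> y) \<otimes>\<^bsub>Q\<^esub> \<pi> w"] y ac \<pi>c by (simp add: Q.m_closed)
  qed
  have c3: "\<pi> y \<otimes>\<^bsub>Q\<^esub> (\<pi> w \<otimes>\<^bsub>Q\<^esub> \<pi> a) = (\<pi> y \<otimes>\<^bsub>Q\<^esub> \<pi> w) \<otimes>\<^bsub>Q\<^esub> \<pi> a" if y: "y \<in> carrier L" "w \<in> carrier L" for y w
  proof -
    have "\<pi> (ldiv L (y \<otimes> w) (y \<otimes> (w \<otimes> a))) = \<pi> a"
      using key[of "LDiv (Mult ?Y ?W) (Mult ?Y (Mult ?W ?X))" "d y w"] y ac d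
      by (simp add: eval_poly_def d01 laws cl ldiv1 ldivQ)
    then have "ldiv Q (\<pi> y \<otimes>\<^bsub>Q\<^esub> \<pi> w) (\<pi> y \<otimes>\<^bsub>Q\<^esub> (\<pi> w \<otimes>\<^bsub>Q\<^esub> \<pi> a)) = \<pi> a" using y ac by (simp add: h cl)
    then show ?thesis using Q.mult_ldiv[of "\<pi> y \<otimes>\<^bsub>Q\<^esub> \<pi> w" "\<pi> y \<otimes>\<^bsub>Q\<^esub> (\<pi> w \<otimes>\<^bsub>Q\<^esub> \<pi> a)"] y ac \<pi>c by (simp add: Q.m_closed)
  qed
  have pre: "\<exists>y\<in>carrier L. x = \<pi> y" if "x \<in> carrier Q" for x using that surj by blast
  have "\<pi> a \<otimes>\<^bsub>Q\<^esub> x = x \<otimes>\<^bsub>Q\<^esub> \<pi> a" if "x \<in> carrier Q" for x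
    using pre[OF that] c1 by blast
  moreover have "\<pi> a \<otimes>\<^bsub>Q\<^esub> (x \<otimes>\<^bsub>Q\<^esub> y) = (\<pi> a \<otimes>\<^bsub>Q\<^esub> x) \<otimes>\<^bsub>Q\<^esub> y \<and> x \<otimes>\<^bsub>Q\<^esub> (y \<otimes>\<^bsub>Q\<^esub> \<pi> a) = (x \<otimes>\<^bsub>Q\<^esub> y) \<otimes>\<^bsub>Q\<^esub> \<pi> a"
    if "x \<in> carrier Q" "y \<in> carrier Q" for x y
    using pre[OF that(1)] pre[OF that(2)] c2 c3 by blast
  ultimately show ?thesis using \<pi>c[OF ac] unfolding loop_center_def by blast
qed

text \<open>Follow the central series of \<open>L\<close> down to the first congruence that \<open>\<pi>\<close> makes trivial. The one before it
  contains a pair with different images, whose quotient has a nontrivial central image.\<close>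

lemma (in loop) nilpotent_image_center:
  assumes nil: "nilpotent_loop L" and Q: "loop Q"
    and surj: "\<pi> ` carrier L = carrier Q"
    and one: "\<pi> \<one>\<^bsub>L\<^esub> = \<one>\<^bsub>Q\<^esub>"
    and hom: "\<And>f x y. x \<in> carrier L \<Longrightarrow> y \<in> carrier L \<Longrightarrow> \<pi> (apply_op L f x y) = apply_op Q f (\<pi> x) (\<pi> y)"
    and nontriv: "carrier Q \<noteq> {\<one>\<^bsub>Q\<^esub>}"
  shows "loop_center Q \<noteq> {\<one>\<^bsub>Q\<^esub>}"
proof -
  interpret Q: loop Q by fact
  obtain k \<alpha> where \<alpha>: "\<And>i. i \<le> k \<Longrightarrow> loop_congruence L (\<alpha> i)" "\<alpha> 0 = total_congruence L" "\<alpha> k = zero_congruence L"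
      "\<And>i. i < k \<Longrightarrow> commutator L (\<alpha> i) (total_congruence L) \<subseteq> \<alpha> (Suc i)"
    using nil unfolding nilpotent_loop_def by blast
  define P where "P j \<longleftrightarrow> (\<forall>x y. (x, y) \<in> \<alpha> j \<longrightarrow> \<pi> x = \<pi> y)" for j
  have "P k" using \<alpha>(3) by (auto simp: P_def)
  moreover have "\<not> P 0"
  proof
    assume "P 0"
    then have "\<pi> x = \<pi> \<one>" if "x \<in> carrier L" for x
      using that one_closed unfolding P_def \<alpha>(2) by blast
    then have "\<pi> x = \<one>\<^bsub>Q\<^esub>" if "x \<in> carrier L" for x using one that by simp
    then have "carrier Q \<subseteq> {\<one>\<^bsub>Q\<^esub>}" unfolding surj[symmetric] by auto
    then show False using nontriv Q.one_closed by auto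
  qed
  ultimately obtain j where j: "j < k" "\<not> P j" "P (Suc j)"
    using ex_least_nat_less[of P k] by blast
  obtain x y where xy: "(x, y) \<in> \<alpha> j" "\<pi> x \<noteq> \<pi> y" using j(2) by (auto simp: P_def)
  have \<alpha>j: "loop_congruence L (\<alpha> j)" using \<alpha>(1) j(1) by simp
  have xyc: "x \<in> carrier L" "y \<in> carrier L" using congruence_carrier[OF \<alpha>j xy(1)] by auto
  define a where "a = rdiv L y x"
  have "(apply_op L Over x x, apply_op L Over y x) \<in> \<alpha> j"
    by (rule congruence_op[OF \<alpha>j xy(1) congruence_refl[OF \<alpha>j xyc(1)]])
  then have a: "(\<one>, a) \<in> \<alpha> j" using rdiv_eqI[of \<one> x x] xyc by (simp add: a_def l_one one_closed)
  have comm: "\<pi> x = \<pi> y" if "(x, y) \<in> commutator L (\<alpha> j) (total_congruence L)" for x y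
    using that \<alpha>(4)[OF j(1)] j(3) unfolding P_def by blast
  have "\<pi> a \<in> loop_center Q"
    by (rule commutator_central_image[OF Q surj one hom \<alpha>j comm a])
  moreover have "\<pi> a \<noteq> \<one>\<^bsub>Q\<^esub>"
  proof
    assume "\<pi> a = \<one>\<^bsub>Q\<^esub>"
    moreover have "\<pi> (a \<otimes> x) = \<pi> a \<otimes>\<^bsub>Q\<^esub> \<pi> x" using hom[of a x Times] xyc by (simp add: a_def rdiv_closed)
    moreover have "\<pi> x \<in> carrier Q" using xyc(1) surj by blast
    ultimately have "\<pi> y = \<pi> x" using xyc by (simp add: a_def mult_rdiv Q.l_one)
    then show False using xy(2) by simp
  qed
  ultimately show ?thesis by auto
qed

lemma two_prime_factors:
  fixes a b p q :: nat
  assumes "prime p" "prime q" "a * b = p * q" "a \<noteq> 1" "b \<noteq> 1"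
  shows "prime a \<and> prime b"
proof -
  have *: "prime a \<and> prime b" if "p dvd a" "a * b = p * q" "a \<noteq> 1" "b \<noteq> 1" for a b
  proof -
    obtain c where c: "a = p * c" using \<open>p dvd a\<close> by blast
    then have "c * b = q" using that(2) prime_gt_0_nat[OF assms(1)] by simp
    then have "c = 1" using prime_product[of c b] assms(2) \<open>b \<noteq> 1\<close> by auto
    then show ?thesis using c \<open>c * b = q\<close> assms by auto
  qed
  have "p dvd a \<or> p dvd b" using assms prime_dvd_multD by (metis dvd_triv_left)
  then show ?thesis using *[of a b] *[of b a] assms by (auto simp: mult.commute)
qed

text \<open>The cosets of the center partition the loop, so the order of a nontrivial proper center is one of the two
  primes and the quotient has the order of the other one. The center of this quotient is
  nontrivial by nilpotence, hence it is the whole quotient. Both groups are then read through their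
  discrete logarithms.\<close>

lemma (in loop) nilpotent_order_pq_structure:
  assumes p: "prime (p::nat)" and q: "prime q" and nil: "nilpotent_loop L" and ord: "order L = p * q"
  obtains (abelian) "loop_center L = carrier L"
  | (central_extension) r s \<beta> \<gamma> where "prime (r::nat)" "prime (s::nat)"
      "\<And>x y. x \<in> carrier L \<Longrightarrow> y \<in> carrier L \<Longrightarrow> [\<beta> (x \<otimes>\<^bsub>L\<^esub> y) = \<beta> x + \<beta> y] (mod int s)"
      "\<And>x y. x \<in> carrier L \<Longrightarrow> y \<in> carrier L \<Longrightarrow> [\<beta> x = \<beta> y] (mod int s) \<Longrightarrow> \<exists>z\<in>loop_center L. y = x \<otimes>\<^bsub>L\<^esub> z"
      "\<And>x y. x \<in> loop_center L \<Longrightarrow> y \<in> loop_center L \<Longrightarrow> [\<gamma> (x \<otimes>\<^bsub>L\<^esub> y) = \<gamma> x + \<gamma> y] (mod int r)"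
      "\<And>x y. x \<in> loop_center L \<Longrightarrow> y \<in> loop_center L \<Longrightarrow> [\<gamma> x = \<gamma> y] (mod int r) \<Longrightarrow> x = y"
proof (cases "loop_center L = carrier L")
  case True
  then show ?thesis by (rule abelian)
next
  case False
  let ?Z = "loop_center L" and ?\<zeta> = "center_relation L"
  let ?Q = "loop_quotient L ?\<zeta>" and ?\<pi> = "\<lambda>x. ?\<zeta> `` {x}"
  have pq: "1 < p" "1 < q" using p q prime_gt_1_nat by auto
  from this have "1 < p * q" by (rule less_1_mult)
  then have fin: "finite (carrier L)" using ord pq by (intro card_ge_0_finite) (simp add: order_def)
  have one_image: "\<one>\<^bsub>?Q\<^esub> = ?\<pi> \<one>" by (simp add: loop_quotient_def)
  interpret Q: loop ?Q by (rule quotient_is_loop[OF center_relation_congruence])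
  have Zsub: "?Z \<subseteq> carrier L" by (auto simp: center_closed)
  have finZ: "finite ?Z" using Zsub fin by (rule finite_subset)
  have "carrier L \<noteq> {\<one>}" using ord \<open>1 < p * q\<close> by (auto simp: order_def)
  then have Znt: "?Z \<noteq> {\<one>}" by (intro nilpotent_image_center[OF nil loop_axioms, of "\<lambda>x. x"]) auto
  then have Z1: "card ?Z \<noteq> 1" using one_center by (auto simp: card_1_singleton_iff)
  have oQ: "p * q = card ?Z * order ?Q" using order_center_quotient[OF fin] ord by simp
  have surj: "?\<pi> ` carrier L = carrier ?Q"
    by (auto simp: loop_quotient_def quotient_def)
  have "card ?Z < card (carrier L)" using False Zsub fin by (intro psubset_card_mono) auto
  then have Q1: "order ?Q \<noteq> 1" using oQ ord by (auto simp: order_def)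
  have primes: "prime (card ?Z) \<and> prime (order ?Q)"
    using two_prime_factors[OF p q oQ[symmetric] Z1 Q1] .
  have Qnt: "carrier ?Q \<noteq> {\<one>\<^bsub>?Q\<^esub>}" using Q1 by (auto simp: order_def)
  have QZ: "loop_center ?Q \<noteq> {\<one>\<^bsub>?Q\<^esub>}"
    by (rule nilpotent_image_center[OF nil Q.loop_axioms surj _ _ Qnt])
       (simp_all add: one_image quotient_op[OF center_relation_congruence])
  have finQ: "finite (carrier ?Q)" using surj fin by (metis finite_imageI)
  have "card (loop_center ?Q) dvd order ?Q" using Q.order_center_quotient[OF finQ] by simp
  moreover have "card (loop_center ?Q) \<noteq> 1" using QZ Q.one_center by (auto simp: card_1_singleton_iff)
  ultimately have "card (loop_center ?Q) = card (carrier ?Q)" using primes by (auto simp: prime_nat_iff order_def)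
  then have "loop_center ?Q = carrier ?Q"
    using finQ Q.center_closed by (intro card_subset_eq) auto
  then interpret QG: comm_group ?Q by (rule Q.abelian_if_center)
  interpret ZG: comm_group "L\<lparr>carrier := ?Z\<rparr>" by (rule center_group)
  obtain \<delta> :: "'a set \<Rightarrow> int" where \<delta>:
    "\<And>x y. x \<in> carrier ?Q \<Longrightarrow> y \<in> carrier ?Q \<Longrightarrow> [\<delta> (x \<otimes>\<^bsub>?Q\<^esub> y) = \<delta> x + \<delta> y] (mod int (order ?Q))"
    "\<And>x y. x \<in> carrier ?Q \<Longrightarrow> y \<in> carrier ?Q \<Longrightarrow> [\<delta> x = \<delta> y] (mod int (order ?Q)) \<Longrightarrow> x = y"
    using QG.prime_order_discrete_log primes by blast
  have oZ: "order (L\<lparr>carrier := ?Z\<rparr>) = card ?Z" by (simp add: order_def)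
  obtain \<gamma> :: "'a \<Rightarrow> int" where \<gamma>:
    "\<And>x y. x \<in> ?Z \<Longrightarrow> y \<in> ?Z \<Longrightarrow> [\<gamma> (x \<otimes> y) = \<gamma> x + \<gamma> y] (mod int (card ?Z))"
    "\<And>x y. x \<in> ?Z \<Longrightarrow> y \<in> ?Z \<Longrightarrow> [\<gamma> x = \<gamma> y] (mod int (card ?Z)) \<Longrightarrow> x = y"
    using ZG.prime_order_discrete_log[unfolded oZ, simplified] primes by blast
  show ?thesis
  proof (rule central_extension[of "card ?Z" "order ?Q" "\<lambda>x. \<delta> (?\<pi> x)" \<gamma>])
    fix x y assume xy: "x \<in> carrier L" "y \<in> carrier L"
    have \<pi>: "?\<pi> x \<in> carrier ?Q" "?\<pi> y \<in> carrier ?Q" using xy surj by blast+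
    show "[\<delta> (?\<pi> (x \<otimes> y)) = \<delta> (?\<pi> x) + \<delta> (?\<pi> y)] (mod int (order ?Q))"
      using \<delta>(1)[OF \<pi>] quotient_op[OF center_relation_congruence xy, of Times] by simp
    assume "[\<delta> (?\<pi> x) = \<delta> (?\<pi> y)] (mod int (order ?Q))"
    then have "?\<pi> x = ?\<pi> y" using \<delta>(2)[OF \<pi>] by blast
    then have "(x, y) \<in> ?\<zeta>" using class_eq_iff[OF center_relation_congruence xy] by simp
    then show "\<exists>z\<in>?Z. y = x \<otimes> z" by (auto simp: center_relation_def)
  qed (use primes \<gamma> in auto)
qed

section \<open>Collapsing functions of residues\<close>

text \<open>A linear combination modulo \<open>p\<close> can be written as a sum with repetitions, because its coefficients may
  be chosen nonnegative.\<close>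

lemma weighted_list:
  fixes w :: "'i \<Rightarrow> int"
  assumes fin: "finite I" and p: "0 < p"
  obtains xs where "set xs \<subseteq> \<sigma> ` I"
    "\<And>f :: _ \<Rightarrow> int. [sum_list (map f xs) = (\<Sum>i\<in>I. w i * f (\<sigma> i))] (mod p)"
proof -
  have "\<exists>xs. set xs \<subseteq> \<sigma> ` I \<and> (\<forall>f :: _ \<Rightarrow> int. [sum_list (map f xs) = (\<Sum>i\<in>I. w i * f (\<sigma> i))] (mod p))"
    using fin
  proof induction
    case empty
    show ?case by (intro exI[of _ "[]"]) simp
  next
    case (insert i I)
    then obtain xs where xs: "set xs \<subseteq> \<sigma> ` I" "\<And>f :: _ \<Rightarrow> int. [sum_list (map f xs) = (\<Sum>i\<in>I. w i * f (\<sigma> i))] (mod p)"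
      by blast
    let ?n = "nat (w i mod p)"
    have "[sum_list (map f (replicate ?n (\<sigma> i) @ xs)) = (\<Sum>i\<in>insert i I. w i * f (\<sigma> i))] (mod p)" for f :: "_ \<Rightarrow> int"
    proof -
      have "[(w i mod p) * f (\<sigma> i) + sum_list (map f xs) = w i * f (\<sigma> i) + (\<Sum>i\<in>I. w i * f (\<sigma> i))] (mod p)"
        by (intro cong_add cong_mult xs(2)) (auto simp: cong_def)
      then show ?thesis using insert p by (simp add: sum_list_replicate)
    qed
    then show ?case using xs(1) by (intro exI[of _ "replicate ?n (\<sigma> i) @ xs"]) auto
  qed
  then show ?thesis using that by blast
qed

definition periodic :: "int \<Rightarrow> (int \<Rightarrow> int) \<Rightarrow> bool" where
  "periodic q h \<longleftrightarrow> (\<forall>x y. [x = y] (mod q) \<longrightarrow> h x = h y)"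

lemma sum_complete_residues:
  fixes h :: "int \<Rightarrow> int"
  assumes q: "0 < q" and d: "coprime d q" and h: "periodic q h"
  shows "(\<Sum>b\<in>{0..<q}. h (a + b * d)) = (\<Sum>x\<in>{0..<q}. h x)"
proof -
  have inj: "inj_on (\<lambda>b. (a + b * d) mod q) {0..<q}"
  proof (rule inj_onI)
    fix b b' assume b: "b \<in> {0..<q}" "b' \<in> {0..<q}" "(a + b * d) mod q = (a + b' * d) mod q"
    then have "[a + b * d = a + b' * d] (mod q)" by (simp add: cong_def)
    then have "[b = b'] (mod q)" using d by (simp add: cong_mult_rcancel cong_add_lcancel)
    then show "b = b'" using b by (simp add: cong_def)
  qed
  have "(\<lambda>b. (a + b * d) mod q) ` {0..<q} = {0..<q}"
    by (rule endo_inj_surj[OF _ _ inj]) (use q in auto)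
  then have bij: "bij_betw (\<lambda>b. (a + b * d) mod q) {0..<q} {0..<q}" using inj by (simp add: bij_betw_def)
  have "h (a + b * d) = h ((a + b * d) mod q)" for b
    by (rule h[unfolded periodic_def, rule_format]) (simp add: cong_def)
  then show ?thesis using sum.reindex_bij_betw[OF bij, of h] by simp
qed

text \<open>If \<open>q\<close> does not divide \<open>d\<close>, both sums run over a complete residue system and cancel.\<close>

lemma line_sum_difference:
  fixes h :: "int \<Rightarrow> int"
  assumes q: "prime q" and h: "periodic q h"
  shows "(\<Sum>b\<in>{0..<q}. h (a + b * d)) - (\<Sum>b\<in>{0..<q}. h (b * d)) = (if q dvd d then q * (h a - h 0) else 0)"
proof (cases "q dvd d")
  case True
  then have "h (a + b * d) = h a" "h (b * d) = h 0" for b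
    using h by (auto simp: periodic_def cong_iff_dvd_diff)
  then show ?thesis using True prime_gt_0_int[OF q] by (simp add: algebra_simps)
next
  case False
  then have "coprime d q" using q prime_imp_coprime by (metis coprime_commute)
  then show ?thesis
    using sum_complete_residues[OF prime_gt_0_int[OF q] _ h, of d a] sum_complete_residues[OF prime_gt_0_int[OF q] _ h, of d 0] False
    by simp
qed

definition biperiodic :: "int \<Rightarrow> (int \<Rightarrow> int \<Rightarrow> int) \<Rightarrow> bool" where
  "biperiodic q \<phi> \<longleftrightarrow> (\<forall>x x' y y'. [x = x'] (mod q) \<longrightarrow> [y = y'] (mod q) \<longrightarrow> \<phi> x y = \<phi> x' y')"

lemma biperiodicD:
  "biperiodic q \<phi> \<Longrightarrow> [x = x'] (mod q) \<Longrightarrow> [y = y'] (mod q) \<Longrightarrow> \<phi> x y = \<phi> x' y'"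
  by (simp add: biperiodic_def)

text \<open>The directions in the plane over the field with \<open>q\<close> elements are \<open>(1, y)\<close> and \<open>(0, 1)\<close>. For a direction
  \<open>u\<close>, let \<open>a\<close> and \<open>d\<close> be linear forms with \<open>a(u) = 1\<close> and \<open>d(u) = 0\<close>, and sum
  \<open>\<phi>((a(v) + b d(v)) u) - \<phi>(b d(v) u)\<close> over all \<open>b\<close>. If \<open>v\<close> is not a multiple of \<open>u\<close>, then \<open>d(v)\<close> is
  not zero and the terms cancel; otherwise \<open>a(v) u = v\<close> and the sum is \<open>q (\<phi>(v) - \<phi>(0))\<close>. A nonzero
  \<open>v\<close> is a multiple of exactly one direction. On the right-hand side \<open>\<phi>\<close> is evaluated only at
  multiples of a fixed vector by a linear form in \<open>v\<close>.\<close>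

lemma radon_inversion:
  fixes \<phi> :: "int \<Rightarrow> int \<Rightarrow> int"
  assumes q: "prime q" and \<phi>: "biperiodic q \<phi>"
  shows "q * (\<phi> v\<^sub>0 v\<^sub>1 - \<phi> 0 0) =
    (\<Sum>y\<in>{0..<q}. \<Sum>b\<in>{0..<q}. \<phi> (v\<^sub>0 + b * (v\<^sub>1 - y * v\<^sub>0)) (y * (v\<^sub>0 + b * (v\<^sub>1 - y * v\<^sub>0)))
        - \<phi> (b * (v\<^sub>1 - y * v\<^sub>0)) (y * (b * (v\<^sub>1 - y * v\<^sub>0))))
    + (\<Sum>b\<in>{0..<q}. \<phi> 0 (v\<^sub>1 + b * v\<^sub>0) - \<phi> 0 (b * v\<^sub>0))"
proof -
  have q0: "0 < q" using prime_gt_0_int[OF q] .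
  have per: "periodic q (\<lambda>x. \<phi> x (y * x))" "periodic q (\<phi> 0)" for y
    by (auto simp: periodic_def intro!: biperiodicD[OF \<phi>] cong_mult)
  have 1: "(\<Sum>b\<in>{0..<q}. \<phi> (v\<^sub>0 + b * (v\<^sub>1 - y * v\<^sub>0)) (y * (v\<^sub>0 + b * (v\<^sub>1 - y * v\<^sub>0)))
        - \<phi> (b * (v\<^sub>1 - y * v\<^sub>0)) (y * (b * (v\<^sub>1 - y * v\<^sub>0))))
      = (if q dvd v\<^sub>1 - y * v\<^sub>0 then q * (\<phi> v\<^sub>0 v\<^sub>1 - \<phi> 0 0) else 0)" for y
  proof -
    have "\<phi> v\<^sub>0 (y * v\<^sub>0) = \<phi> v\<^sub>0 v\<^sub>1" if "q dvd v\<^sub>1 - y * v\<^sub>0"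
      using that by (intro biperiodicD[OF \<phi>]) (auto simp: cong_iff_dvd_diff dvd_diff_commute)
    then show ?thesis using line_sum_difference[OF q per(1)[of y], of v\<^sub>0 "v\<^sub>1 - y * v\<^sub>0"] by (simp add: sum_subtractf)
  qed
  have 2: "(\<Sum>b\<in>{0..<q}. \<phi> 0 (v\<^sub>1 + b * v\<^sub>0) - \<phi> 0 (b * v\<^sub>0)) = (if q dvd v\<^sub>0 then q * (\<phi> v\<^sub>0 v\<^sub>1 - \<phi> 0 0) else 0)"
  proof -
    have "\<phi> 0 v\<^sub>1 = \<phi> v\<^sub>0 v\<^sub>1" if "q dvd v\<^sub>0"
      using that by (intro biperiodicD[OF \<phi>]) (auto simp: cong_iff_dvd_diff)
    then show ?thesis using line_sum_difference[OF q per(2), of v\<^sub>1 v\<^sub>0] by (simp add: sum_subtractf)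
  qed
  show ?thesis
  proof (cases "q dvd v\<^sub>0")
    case True
    have "(if q dvd v\<^sub>1 - y * v\<^sub>0 then q * (\<phi> v\<^sub>0 v\<^sub>1 - \<phi> 0 0) else 0) = 0" for y
    proof (cases "q dvd v\<^sub>1 - y * v\<^sub>0")
      case t: True
      have "q dvd (v\<^sub>1 - y * v\<^sub>0) + y * v\<^sub>0" using t True by (intro dvd_add dvd_mult)
      then have "q dvd v\<^sub>1" by simp
      then have "\<phi> v\<^sub>0 v\<^sub>1 = \<phi> 0 0" using True by (intro biperiodicD[OF \<phi>]) (auto simp: cong_iff_dvd_diff)
      then show ?thesis by simp
    qed simp
    then show ?thesis unfolding 1 2 using True by simp
  next
    case False
    then have cop: "coprime v\<^sub>0 q" using q prime_imp_coprime by (metis coprime_commute)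
    obtain y\<^sub>1 where y1: "[v\<^sub>0 * y\<^sub>1 = 1] (mod q)" using cong_solve_coprime_int[OF cop] by blast
    define y\<^sub>0 where "y\<^sub>0 = (y\<^sub>1 * v\<^sub>1) mod q"
    have y0: "y\<^sub>0 \<in> {0..<q}" "[v\<^sub>0 * y\<^sub>0 = v\<^sub>1] (mod q)"
    proof -
      show "y\<^sub>0 \<in> {0..<q}" using q0 by (simp add: y\<^sub>0_def)
      have "[v\<^sub>0 * y\<^sub>0 = v\<^sub>0 * (y\<^sub>1 * v\<^sub>1)] (mod q)" by (intro cong_mult) (auto simp: y\<^sub>0_def)
      also have "[v\<^sub>0 * (y\<^sub>1 * v\<^sub>1) = v\<^sub>1] (mod q)" using cong_mult[OF y1 cong_refl[of v\<^sub>1]] by (simp add: mult_ac)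
      finally show "[v\<^sub>0 * y\<^sub>0 = v\<^sub>1] (mod q)" .
    qed
    have "q dvd v\<^sub>1 - y * v\<^sub>0 \<longleftrightarrow> y = y\<^sub>0" if "y \<in> {0..<q}" for y
    proof -
      have "q dvd v\<^sub>1 - y * v\<^sub>0 \<longleftrightarrow> [v\<^sub>0 * y = v\<^sub>1] (mod q)"
        by (simp add: cong_iff_dvd_diff dvd_diff_commute mult.commute)
      also have "\<dots> \<longleftrightarrow> [v\<^sub>0 * y = v\<^sub>0 * y\<^sub>0] (mod q)" using y0(2) cong_trans cong_sym by blast
      also have "\<dots> \<longleftrightarrow> [y = y\<^sub>0] (mod q)" using cop by (simp add: cong_mult_lcancel)
      also have "\<dots> \<longleftrightarrow> y = y\<^sub>0" using that y0(1) by (simp add: cong_def)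
      finally show ?thesis .
    qed
    then have "(\<Sum>y\<in>{0..<q}. if q dvd v\<^sub>1 - y * v\<^sub>0 then q * (\<phi> v\<^sub>0 v\<^sub>1 - \<phi> 0 0) else 0)
        = (\<Sum>y\<in>{0..<q}. if y = y\<^sub>0 then q * (\<phi> v\<^sub>0 v\<^sub>1 - \<phi> 0 0) else 0)"
      by (intro sum.cong) auto
    also have "\<dots> = q * (\<phi> v\<^sub>0 v\<^sub>1 - \<phi> 0 0)" using y0(1) by (simp add: sum.delta)
    finally show ?thesis unfolding 1 2 using False by simp
  qed
qed

lemma alternating_binomial_cong:
  fixes g :: "nat \<Rightarrow> int"
  assumes p: "prime p" and g: "g p = g 0"
  shows "[(\<Sum>j\<le>p. (-1) ^ j * int (p choose j) * g j) = 0] (mod int p)"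
proof -
  have p1: "1 < p" using p by (rule prime_gt_1_nat)
  have "(\<Sum>j\<le>p. (-1) ^ j * int (p choose j) * g j) = (\<Sum>j\<in>{0, p} \<union> {1..<p}. (-1) ^ j * int (p choose j) * g j)"
    by (intro sum.cong) auto
  also have "\<dots> = g 0 + (-1) ^ p * g p + (\<Sum>j\<in>{1..<p}. (-1) ^ j * int (p choose j) * g j)"
    using p1 by (subst sum.union_disjoint) auto
  finally have eq: "(\<Sum>j\<le>p. (-1) ^ j * int (p choose j) * g j) = (1 + (-1) ^ p) * g 0 + (\<Sum>j\<in>{1..<p}. (-1) ^ j * int (p choose j) * g j)"
    using g by (simp add: algebra_simps)
  have "int p dvd (\<Sum>j\<in>{1..<p}. (-1) ^ j * int (p choose j) * g j)"
  proof (rule dvd_sum)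
    fix j assume "j \<in> {1..<p}"
    then have "p dvd (p choose j)" using p by (intro dvd_choose_prime) auto
    then show "int p dvd (-1) ^ j * int (p choose j) * g j" by simp
  qed
  moreover have "int p dvd 1 + (-1) ^ p"
  proof (cases "p = 2")
    case False
    then have "odd p" using p prime_odd_nat p1 by auto
    then show ?thesis by simp
  qed simp
  ultimately show ?thesis unfolding eq cong_0_iff by (intro dvd_add[OF dvd_mult2])
qed

text \<open>Among \<open>p\<^sup>3\<close> pairs \<open>(x i, y i)\<close> some value modulo \<open>p\<close> is taken \<open>p\<close> times. Group the subsets by their part
  outside a set \<open>I\<close> of \<open>p\<close> such indices: the summand then depends only on the number \<open>j\<close> of chosen elements
  of \<open>I\<close> and has multiplicity \<open>p choose j\<close>.\<close>

lemma alternating_subset_sum: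
  fixes \<Psi> :: "int \<Rightarrow> int \<Rightarrow> int" and x y :: "nat \<Rightarrow> int"
  assumes p: "prime p" and \<Psi>: "biperiodic (int p) \<Psi>" and m: "p ^ 3 \<le> m"
  shows "[(\<Sum>S\<in>Pow {..<m}. (-1) ^ card S * \<Psi> (\<Sum>i\<in>S. x i) (\<Sum>i\<in>S. y i)) = 0] (mod int p)"
proof -
  have p0: "0 < p" using p prime_gt_0_nat by blast
  define c where "c i = (x i mod int p, y i mod int p)" for i
  have "\<exists>v\<in>{0..<int p} \<times> {0..<int p}. p \<le> card {i\<in>{..<m}. c i = v}"
  proof (rule ccontr)
    assume "\<not> ?thesis"
    then have lt: "card {i\<in>{..<m}. c i = v} \<le> p - 1" if "v \<in> {0..<int p} \<times> {0..<int p}" for v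
      using that by (metis Suc_pred' le_less_Suc_eq less_Suc_eq_le linorder_not_le p0)
    have "m = card {..<m}" by simp
    also have "\<dots> = (\<Sum>v\<in>{0..<int p} \<times> {0..<int p}. card {i\<in>{..<m}. c i = v})"
      using p0 by (subst card_eq_sum, subst sum.group[symmetric, where g = c and T = "{0..<int p} \<times> {0..<int p}"])
        (auto simp: c_def)
    also have "\<dots> \<le> (\<Sum>v\<in>{0..<int p} \<times> {0..<int p}. p - 1)" by (intro sum_mono lt)
    also have "\<dots> = p * p * (p - 1)" by simp
    also have "\<dots> < p ^ 3" using p0 by (simp add: power3_eq_cube)
    finally show False using m by simp
  qed
  then obtain v where "p \<le> card {i\<in>{..<m}. c i = v}" by blast
  then obtain I where I: "I \<subseteq> {i\<in>{..<m}. c i = v}" "card I = p" "finite I"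
    by (rule obtain_subset_with_card_n)
  define J where "J = {..<m} - I"
  obtain a b where v: "v = (a, b)" by (cases v)
  have xI: "[x i = a] (mod int p)" "[y i = b] (mod int p)" if "i \<in> I" for i
    using that I v by (auto simp: c_def cong_def)
  have bij: "bij_betw (\<lambda>(S, T). S \<union> T) (Pow J \<times> Pow I) (Pow {..<m})"
    by (rule bij_betw_byWitness[where f' = "\<lambda>S. (S - I, S \<inter> I)"]) (use I in \<open>auto simp: J_def\<close>)
  have "(\<Sum>S\<in>Pow {..<m}. (-1) ^ card S * \<Psi> (\<Sum>i\<in>S. x i) (\<Sum>i\<in>S. y i))
      = (\<Sum>(S, T)\<in>Pow J \<times> Pow I. (-1) ^ card (S \<union> T) * \<Psi> (\<Sum>i\<in>S \<union> T. x i) (\<Sum>i\<in>S \<union> T. y i))"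
    using sum.reindex_bij_betw[OF bij, of "\<lambda>S. (-1) ^ card S * \<Psi> (\<Sum>i\<in>S. x i) (\<Sum>i\<in>S. y i)"]
    by (simp add: case_prod_unfold)
  also have "\<dots> = (\<Sum>S\<in>Pow J. \<Sum>T\<in>Pow I. (-1) ^ card (S \<union> T) * \<Psi> (\<Sum>i\<in>S \<union> T. x i) (\<Sum>i\<in>S \<union> T. y i))"
    by (simp add: sum.cartesian_product)
  also have "[\<dots> = (\<Sum>S\<in>Pow J. 0)] (mod int p)"
  proof (rule cong_sum)
    fix S assume "S \<in> Pow J"
    then have S: "finite S" "S \<inter> I = {}" by (auto simp: J_def intro: finite_subset)
    define g where "g j = \<Psi> ((\<Sum>i\<in>S. x i) + int j * a) ((\<Sum>i\<in>S. y i) + int j * b)" for j :: nat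
    have T: "(-1) ^ card (S \<union> T) * \<Psi> (\<Sum>i\<in>S \<union> T. x i) (\<Sum>i\<in>S \<union> T. y i) = (-1) ^ card S * ((-1) ^ card T * g (card T))"
      if "T \<in> Pow I" for T
    proof -
      have T: "finite T" "S \<inter> T = {}" "T \<subseteq> I" using that I S by (auto intro: finite_subset)
      have "[(\<Sum>i\<in>T. x i) = (\<Sum>i\<in>T. a)] (mod int p)" "[(\<Sum>i\<in>T. y i) = (\<Sum>i\<in>T. b)] (mod int p)"
        by (intro cong_sum xI; use T in auto)+
      then have "\<Psi> (\<Sum>i\<in>S \<union> T. x i) (\<Sum>i\<in>S \<union> T. y i) = g (card T)"
        using S T unfolding g_def
        by (intro biperiodicD[OF \<Psi>]) (simp_all add: sum.union_disjoint cong_add_lcancel)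
      then show ?thesis using S T by (simp add: card_Un_disjoint power_add)
    qed
    have "(\<Sum>T\<in>Pow I. (-1) ^ card T * g (card T)) = (\<Sum>j\<le>p. \<Sum>T\<in>{T\<in>Pow I. card T = j}. (-1) ^ card T * g (card T))"
      using I by (intro sum.group[symmetric]) (auto intro: card_mono)
    also have "\<dots> = (\<Sum>j\<le>p. (-1) ^ j * int (p choose j) * g j)"
    proof (rule sum.cong[OF HOL.refl])
      fix j
      have "card {T\<in>Pow I. card T = j} = p choose j" using n_subsets[OF I(3), of j] I(2) by simp
      then show "(\<Sum>T\<in>{T\<in>Pow I. card T = j}. (-1) ^ card T * g (card T)) = (-1) ^ j * int (p choose j) * g j"
        by simp
    qed
    also have "[\<dots> = 0] (mod int p)"
      by (intro alternating_binomial_cong[OF p]) (auto simp: g_def cong_iff_dvd_diff intro!: biperiodicD[OF \<Psi>])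
    finally have "[(-1) ^ card S * (\<Sum>T\<in>Pow I. (-1) ^ card T * g (card T)) = (-1) ^ card S * 0] (mod int p)"
      by (intro cong_mult cong_refl)
    then show "[(\<Sum>T\<in>Pow I. (-1) ^ card (S \<union> T) * \<Psi> (\<Sum>i\<in>S \<union> T. x i) (\<Sum>i\<in>S \<union> T. y i)) = 0] (mod int p)"
      by (simp add: T sum_distrib_left)
  qed
  finally show ?thesis by simp
qed

section \<open>Evaluating terms modulo the center\<close>

text \<open>Modulo the center, evaluating a term means evaluating it in an abelian group of prime order, and
  discrete logarithms translate this to evaluation in the additive group of the integers.\<close>

definition int_loop :: "int loop" where
  "int_loop = \<lparr>carrier = UNIV, monoid.mult = (+), one = 0, ldiv = (\<lambda>x y. y - x), rdiv = (\<lambda>y x. y - x)\<rparr>"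

lemma int_loop_simps [simp]:
  "x \<otimes>\<^bsub>int_loop\<^esub> y = x + y" "\<one>\<^bsub>int_loop\<^esub> = 0" "ldiv int_loop x y = y - x" "rdiv int_loop y x = y - x"
  by (simp_all add: int_loop_def)

lemma int_loop_op_cong:
  "[x = x'] (mod s) \<Longrightarrow> [y = y'] (mod s) \<Longrightarrow> [apply_op int_loop f x y = apply_op int_loop f x' y'] (mod s)"
  by (cases f) (auto intro: cong_add cong_diff)

lemma int_loop_op_add:
  "apply_op int_loop f (x + x') (y + y') = apply_op int_loop f x y + apply_op int_loop f x' y'"
  by (cases f) auto

lemma eval_int_cong:
  "(\<And>i. [v i = v' i] (mod s)) \<Longrightarrow> [eval_lterm int_loop v t = eval_lterm int_loop v' t] (mod s)"
  by (induction t rule: lterm_op_induct) (auto intro: int_loop_op_cong)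

lemma eval_int_linear:
  fixes t :: "nat lterm"
  assumes "set_lterm t \<subseteq> {..<m}"
  obtains k where "\<And>v. eval_lterm int_loop v t = (\<Sum>i<m. k i * v i)"
proof -
  have "\<exists>k. \<forall>v. eval_lterm int_loop v t = (\<Sum>i<m. k i * v i)"
    using assms
  proof (induction t rule: lterm_op_induct)
    case (Var j)
    then have "(\<Sum>i<m. (if i = j then 1 else 0) * v i) = v j" for v :: "nat \<Rightarrow> int"
      by (subst sum.cong[OF HOL.refl, of _ _ "\<lambda>i. if i = j then v j else 0"]) auto
    then show ?case by (intro exI[of _ "\<lambda>i. if i = j then 1 else 0"]) simp
  next
    case One
    show ?case by (intro exI[of _ "\<lambda>i. 0"]) simp
  next
    case (Op f s t)
    then obtain k l where "\<And>v. eval_lterm int_loop v s = (\<Sum>i<m. k i * v i)" "\<And>v. eval_lterm int_loop v t = (\<Sum>i<m. l i * v i)"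
      by auto
    then show ?case
      by (intro exI[of _ "\<lambda>i. apply_op int_loop f (k i) (l i)"], cases f)
        (auto simp: sum.distrib sum_subtractf algebra_simps)
  qed
  then show ?thesis using that by blast
qed

section \<open>Degenerate substitutions that recover every function\<close>

definition int_collapses :: "int \<Rightarrow> int \<Rightarrow> nat \<Rightarrow> (nat \<Rightarrow> nat lterm) list \<Rightarrow> bool" where
  "int_collapses r s m \<Sigma> \<longleftrightarrow> (\<forall>\<Psi> t u v. biperiodic s \<Psi> \<longrightarrow> set_lterm t \<subseteq> {..<m} \<longrightarrow> set_lterm u \<subseteq> {..<m} \<longrightarrow>
     [\<Psi> (eval_lterm int_loop v t) (eval_lterm int_loop v u) =
      sum_list (map (\<lambda>\<sigma>. \<Psi> (eval_lterm int_loop (\<lambda>i. eval_lterm int_loop v (\<sigma> i)) t)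
                          (eval_lterm int_loop (\<lambda>i. eval_lterm int_loop v (\<sigma> i)) u)) \<Sigma>)] (mod r))"

text \<open>The substitutions set the variables outside a proper subset \<open>S\<close> of the block to the unit. The alternating
  sum over all subsets vanishes, so its term for the full block is a combination of the others.\<close>

lemma int_collapses_equal_primes:
  assumes p: "prime p"
  obtains \<Sigma> where "\<And>\<sigma>. \<sigma> \<in> set \<Sigma> \<Longrightarrow> degenerate_subst (p ^ 3) \<sigma>" "int_collapses (int p) (int p) (p ^ 3) \<Sigma>"
proof -
  let ?m = "p ^ 3"
  define \<sigma> where "\<sigma> S = (\<lambda>i. if i \<in> S then Var i else One)" for S :: "nat set"
  define I where "I = Pow {..<?m} - {{..<?m}}"
  obtain \<Sigma> where \<Sigma>: "set \<Sigma> \<subseteq> \<sigma> ` I"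
      "\<And>f :: _ \<Rightarrow> int. [sum_list (map f \<Sigma>) = (\<Sum>S\<in>I. - ((-1) ^ ?m * (-1) ^ card S) * f (\<sigma> S))] (mod int p)"
    using weighted_list[of I "int p" \<sigma> "\<lambda>S. - ((-1) ^ ?m * (-1) ^ card S)"] prime_gt_0_nat[OF p]
    by (auto simp: I_def)
  show ?thesis
  proof (rule that)
    fix \<tau> assume "\<tau> \<in> set \<Sigma>"
    then obtain S where S: "S \<subset> {..<?m}" "\<tau> = \<sigma> S" using \<Sigma>(1) by (auto simp: I_def)
    have "set_lterm (\<sigma> S i) \<subseteq> S" for i by (simp add: \<sigma>_def)
    then have "(\<Union>i<?m. set_lterm (\<sigma> S i)) \<subset> {..<?m}" "\<forall>i<?m. set_lterm (\<sigma> S i) \<subseteq> {..<?m}" using S(1) by blast+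
    then show "degenerate_subst ?m \<tau>"
      unfolding degenerate_subst_def S(2) by (intro conjI exI[of _ "\<sigma> S"] exI[of _ Var]) simp_all
  next
    show "int_collapses (int p) (int p) ?m \<Sigma>"
      unfolding int_collapses_def
    proof (intro allI impI)
      fix \<Psi> :: "int \<Rightarrow> int \<Rightarrow> int" and t u :: "nat lterm" and v :: "nat \<Rightarrow> int"
      assume \<Psi>: "biperiodic (int p) \<Psi>" and tu: "set_lterm t \<subseteq> {..<?m}" "set_lterm u \<subseteq> {..<?m}"
      obtain k where k: "\<And>v. eval_lterm int_loop v t = (\<Sum>i<?m. k i * v i)" using eval_int_linear[OF tu(1)] by blast
      obtain l where l: "\<And>v. eval_lterm int_loop v u = (\<Sum>i<?m. l i * v i)" using eval_int_linear[OF tu(2)] by blast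
      define F where "F S = \<Psi> (\<Sum>i\<in>S. k i * v i) (\<Sum>i\<in>S. l i * v i)" for S
      define G where "G \<tau> = \<Psi> (eval_lterm int_loop (\<lambda>i. eval_lterm int_loop v (\<tau> i)) t)
          (eval_lterm int_loop (\<lambda>i. eval_lterm int_loop v (\<tau> i)) u)" for \<tau> :: "nat \<Rightarrow> nat lterm"
      have restr: "(\<Sum>i<?m. c i * eval_lterm int_loop v (\<sigma> S i)) = (\<Sum>i\<in>S. c i * v i)" if "S \<subseteq> {..<?m}" for c S
      proof -
        have "(\<Sum>i<?m. c i * eval_lterm int_loop v (\<sigma> S i)) = (\<Sum>i<?m. if i \<in> S then c i * v i else 0)"
          by (intro sum.cong) (auto simp: \<sigma>_def)
        also have "\<dots> = (\<Sum>i\<in>{..<?m} \<inter> S. c i * v i)" by (rule sum.inter_restrict[symmetric]) simp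
        also have "{..<?m} \<inter> S = S" using that by blast
        finally show ?thesis .
      qed
      have GF: "G (\<sigma> S) = F S" if "S \<subseteq> {..<?m}" for S
        by (simp only: G_def F_def k l restr[OF that])
      define e :: int where "e = (-1) ^ ?m"
      have "[(\<Sum>S\<in>Pow {..<?m}. (-1) ^ card S * F S) = 0] (mod int p)"
        unfolding F_def by (rule alternating_subset_sum[OF p \<Psi> order_refl])
      also have "(\<Sum>S\<in>Pow {..<?m}. (-1) ^ card S * F S) = (-1) ^ ?m * F {..<?m} + (\<Sum>S\<in>I. (-1) ^ card S * F S)"
        unfolding I_def by (subst sum.remove[of _ "{..<?m}"]) auto
      finally have "[e * (e * F {..<?m} + (\<Sum>S\<in>I. (-1) ^ card S * F S)) = e * 0] (mod int p)"
        unfolding e_def by (intro cong_mult cong_refl)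
      moreover have "e * e = 1" by (simp add: e_def flip: power_add mult_2)
      then have "e * (e * F {..<?m} + (\<Sum>S\<in>I. (-1) ^ card S * F S)) = F {..<?m} + (\<Sum>S\<in>I. e * (-1) ^ card S * F S)"
        by (simp add: distrib_left sum_distrib_left flip: mult.assoc)
      ultimately have "[F {..<?m} + (\<Sum>S\<in>I. e * (-1) ^ card S * F S) = 0] (mod int p)" by simp
      then have "[F {..<?m} = (\<Sum>S\<in>I. - ((-1) ^ ?m * (-1) ^ card S) * F S)] (mod int p)"
        by (simp add: e_def cong_iff_dvd_diff sum_negf)
      also have "(\<Sum>S\<in>I. - ((-1) ^ ?m * (-1) ^ card S) * F S) = (\<Sum>S\<in>I. - ((-1) ^ ?m * (-1) ^ card S) * G (\<sigma> S))"
        by (intro sum.cong) (auto simp: I_def GF)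
      also have "[\<dots> = sum_list (map G \<Sigma>)] (mod int p)" using \<Sigma>(2)[of G] by (rule cong_sym)
      finally show "[\<Psi> (eval_lterm int_loop v t) (eval_lterm int_loop v u) =
        sum_list (map (\<lambda>\<sigma>. \<Psi> (eval_lterm int_loop (\<lambda>i. eval_lterm int_loop v (\<sigma> i)) t)
                          (eval_lterm int_loop (\<lambda>i. eval_lterm int_loop v (\<sigma> i)) u)) \<Sigma>)] (mod int p)"
        by (simp only: F_def G_def[abs_def] k l)
    qed
  qed
qed

primrec power_term :: "nat lterm \<Rightarrow> nat \<Rightarrow> nat lterm" where
  "power_term t 0 = One"
| "power_term t (Suc n) = Mult (power_term t n) t"

lemma eval_power_term [simp]: "eval_lterm int_loop v (power_term t n) = int n * eval_lterm int_loop v t"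
  by (induction n) (auto simp: algebra_simps)

lemma set_power_term: "set_lterm (power_term t n) \<subseteq> set_lterm t"
  by (induction n) auto

text \<open>This is the linear map \<open>v \<mapsto> (a v\<^sub>0 + b v\<^sub>1) (c\<^sub>0, c\<^sub>1)\<close> modulo \<open>s\<close>, written with nonnegative exponents. It factors
  through the single variable \<open>a v\<^sub>0 + b v\<^sub>1\<close>.\<close>

definition rank_one_subst :: "int \<Rightarrow> int \<Rightarrow> int \<Rightarrow> int \<Rightarrow> int \<Rightarrow> nat \<Rightarrow> nat lterm" where
  "rank_one_subst s c\<^sub>0 c\<^sub>1 a b i = power_term
     (Mult (power_term (Var 0) (nat (a mod s))) (power_term (Var 1) (nat (b mod s))))
     (nat ((if i = 0 then c\<^sub>0 else c\<^sub>1) mod s))"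

lemma subst_power_term: "subst_lterm Q (power_term t n) = power_term (subst_lterm Q t) n"
  by (induction n) auto

lemma rank_one_degenerate: "degenerate_subst 2 (rank_one_subst s c\<^sub>0 c\<^sub>1 a b)"
proof -
  define z :: "nat lterm" where "z = Mult (power_term (Var 0) (nat (a mod s))) (power_term (Var 1) (nat (b mod s)))"
  define P :: "nat \<Rightarrow> nat lterm" where "P i = power_term (Var 0) (nat ((if i = 0 then c\<^sub>0 else c\<^sub>1) mod s))" for i
  have eq: "rank_one_subst s c\<^sub>0 c\<^sub>1 a b i = subst_lterm (\<lambda>_. z) (P i)" for i
    by (simp add: rank_one_subst_def P_def z_def subst_power_term)
  have "set_lterm z \<subseteq> {0, 1}" using set_power_term by (fastforce simp: z_def)
  then have z: "set_lterm z \<subseteq> {..<2}" by auto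
  have P: "set_lterm (P i) \<subseteq> {0}" for i using set_power_term[of "Var 0"] by (simp add: P_def)
  have "(\<Union>i<2. set_lterm (P i)) \<subseteq> {0}" using P by blast
  moreover have "0 \<in> {..<2::nat}" "1 \<in> {..<2::nat}" "(1::nat) \<notin> {0}" by simp_all
  ultimately have "(\<Union>i<2. set_lterm (P i)) \<subset> {..<2}" by blast
  then show ?thesis
    unfolding degenerate_subst_def
    by (intro conjI exI[of _ P] exI[of _ "\<lambda>_. z"]) (use z eq in \<open>auto simp: set_subst\<close>)
qed

lemma eval_rank_one:
  assumes "0 < s"
  shows "[eval_lterm int_loop v (rank_one_subst s c\<^sub>0 c\<^sub>1 a b i) = (if i = 0 then c\<^sub>0 else c\<^sub>1) * (a * v 0 + b * v 1)] (mod s)"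
proof -
  have "[(if i = 0 then c\<^sub>0 else c\<^sub>1) mod s * ((a mod s) * v 0 + (b mod s) * v 1) = (if i = 0 then c\<^sub>0 else c\<^sub>1) * (a * v 0 + b * v 1)] (mod s)"
    by (intro cong_mult cong_add cong_refl) (simp_all add: cong_def)
  then show ?thesis using assms by (simp add: rank_one_subst_def)
qed

text \<open>The inversion formula \<open>radon_inversion\<close>, multiplied by an inverse \<open>w\<close> of \<open>s\<close> modulo \<open>r\<close>. The lists \<open>A\<close>,
  \<open>B\<close>, \<open>C\<close>, \<open>D\<close> are its four sums, and one further substitution contributes the value at the origin.\<close>

lemma int_collapses_distinct_primes:
  fixes r s :: int
  assumes r: "prime r" and s: "prime s" and ne: "r \<noteq> s"
  obtains \<Sigma> where "\<And>\<sigma>. \<sigma> \<in> set \<Sigma> \<Longrightarrow> degenerate_subst 2 \<sigma>" "int_collapses r s 2 \<Sigma>"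
proof -
  have r0: "0 < r" and s0: "0 < s" using prime_gt_0_int r s by auto
  have "coprime s r" using r s ne primes_coprime by blast
  then obtain w where w: "[s * w = 1] (mod r)" using cong_solve_coprime_int by blast
  let ?S = "rank_one_subst s"
  let ?I = "{0..<s} \<times> {0..<s}"
  obtain A where A: "set A \<subseteq> (\<lambda>(y, b). ?S 1 y (1 - b * y) b) ` ?I"
      "\<And>f :: _ \<Rightarrow> int. [sum_list (map f A) = (\<Sum>(y, b)\<in>?I. w * f (?S 1 y (1 - b * y) b))] (mod r)"
    using weighted_list[of ?I r "\<lambda>(y, b). ?S 1 y (1 - b * y) b" "\<lambda>_. w"] r0 by (auto simp: case_prod_unfold)
  obtain B where B: "set B \<subseteq> (\<lambda>(y, b). ?S 1 y (- b * y) b) ` ?I"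
      "\<And>f :: _ \<Rightarrow> int. [sum_list (map f B) = (\<Sum>(y, b)\<in>?I. - w * f (?S 1 y (- b * y) b))] (mod r)"
    using weighted_list[of ?I r "\<lambda>(y, b). ?S 1 y (- b * y) b" "\<lambda>_. - w"] r0 by (auto simp: case_prod_unfold)
  obtain C where C: "set C \<subseteq> (\<lambda>b. ?S 0 1 b 1) ` {0..<s}"
      "\<And>f :: _ \<Rightarrow> int. [sum_list (map f C) = (\<Sum>b\<in>{0..<s}. w * f (?S 0 1 b 1))] (mod r)"
    using weighted_list[of "{0..<s}" r "\<lambda>b. ?S 0 1 b 1" "\<lambda>_. w"] r0 by auto
  obtain D where D: "set D \<subseteq> (\<lambda>b. ?S 0 1 b 0) ` {0..<s}"
      "\<And>f :: _ \<Rightarrow> int. [sum_list (map f D) = (\<Sum>b\<in>{0..<s}. - w * f (?S 0 1 b 0))] (mod r)"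
    using weighted_list[of "{0..<s}" r "\<lambda>b. ?S 0 1 b 0" "\<lambda>_. - w"] r0 by auto
  define \<Sigma> where "\<Sigma> = ?S 0 0 0 0 # A @ B @ C @ D"
  show ?thesis
  proof (rule that)
    fix \<sigma> assume "\<sigma> \<in> set \<Sigma>"
    then have "\<exists>c\<^sub>0 c\<^sub>1 a b. \<sigma> = ?S c\<^sub>0 c\<^sub>1 a b" unfolding \<Sigma>_def
      by (auto dest!: subsetD[OF A(1)] subsetD[OF B(1)] subsetD[OF C(1)] subsetD[OF D(1)])
    then show "degenerate_subst 2 \<sigma>" using rank_one_degenerate by auto
  next
    show "int_collapses r s 2 \<Sigma>"
      unfolding int_collapses_def
    proof (intro allI impI)
      fix \<Psi> :: "int \<Rightarrow> int \<Rightarrow> int" and t u :: "nat lterm" and v :: "nat \<Rightarrow> int"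
      assume \<Psi>: "biperiodic s \<Psi>" and tu: "set_lterm t \<subseteq> {..<2}" "set_lterm u \<subseteq> {..<2}"
      define vec where "vec x y = (\<lambda>i::nat. if i = 0 then x else y)" for x y :: int
      define \<phi> where "\<phi> x y = \<Psi> (eval_lterm int_loop (vec x y) t) (eval_lterm int_loop (vec x y) u)" for x y
      have \<phi>: "biperiodic s \<phi>"
        unfolding biperiodic_def \<phi>_def by (intro allI impI biperiodicD[OF \<Psi>] eval_int_cong) (auto simp: vec_def)
      have eval_vec: "eval_lterm int_loop x t' = eval_lterm int_loop (vec (x 0) (x 1)) t'" if "set_lterm t' \<subseteq> {..<2}" for x t'
        using that by (intro eval_cong) (auto simp: vec_def less_2_cases_iff)
      define G where "G \<tau> = \<Psi> (eval_lterm int_loop (\<lambda>i. eval_lterm int_loop v (\<tau> i)) t)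
          (eval_lterm int_loop (\<lambda>i. eval_lterm int_loop v (\<tau> i)) u)" for \<tau> :: "nat \<Rightarrow> nat lterm"
      have G: "G (?S c\<^sub>0 c\<^sub>1 a b) = \<phi> x y"
        if "x = c\<^sub>0 * (a * v 0 + b * v 1)" "y = c\<^sub>1 * (a * v 0 + b * v 1)" for c\<^sub>0 c\<^sub>1 a b x y
        unfolding G_def \<phi>_def that
        by (subst eval_vec[OF tu(1)], subst eval_vec[OF tu(2)], intro biperiodicD[OF \<Psi>] eval_int_cong)
          (use eval_rank_one[OF s0, of v c\<^sub>0 c\<^sub>1 a b 0] eval_rank_one[OF s0, of v c\<^sub>0 c\<^sub>1 a b 1] in \<open>auto simp: vec_def\<close>)
      let ?z = "\<lambda>y b. v 0 + b * (v 1 - y * v 0)" and ?z' = "\<lambda>y b. b * (v 1 - y * v 0)"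
      have GA: "G (?S 1 y (1 - b * y) b) = \<phi> (?z y b) (y * ?z y b)" for y b by (rule G) (simp_all add: algebra_simps)
      have GB: "G (?S 1 y (- b * y) b) = \<phi> (?z' y b) (y * ?z' y b)" for y b by (rule G) (simp_all add: algebra_simps)
      have GC: "G (?S 0 1 b 1) = \<phi> 0 (v 1 + b * v 0)" for b by (rule G) (simp_all add: algebra_simps)
      have GD: "G (?S 0 1 b 0) = \<phi> 0 (b * v 0)" for b by (rule G) simp_all
      have G0: "G (?S 0 0 0 0) = \<phi> 0 0" by (rule G) simp_all
      have "[sum_list (map G \<Sigma>) = \<phi> 0 0 + ((\<Sum>(y, b)\<in>?I. w * \<phi> (?z y b) (y * ?z y b)) +
          ((\<Sum>(y, b)\<in>?I. - w * \<phi> (?z' y b) (y * ?z' y b)) +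
          ((\<Sum>b\<in>{0..<s}. w * \<phi> 0 (v 1 + b * v 0)) + (\<Sum>b\<in>{0..<s}. - w * \<phi> 0 (b * v 0)))))] (mod r)"
        unfolding \<Sigma>_def map_append list.map sum_list_append sum_list.Cons
        using A(2)[of G] B(2)[of G] C(2)[of G] D(2)[of G]
        by (intro cong_add) (simp_all only: GA GB GC GD G0 cong_refl)
      also have "\<phi> 0 0 + ((\<Sum>(y, b)\<in>?I. w * \<phi> (?z y b) (y * ?z y b)) +
          ((\<Sum>(y, b)\<in>?I. - w * \<phi> (?z' y b) (y * ?z' y b)) +
          ((\<Sum>b\<in>{0..<s}. w * \<phi> 0 (v 1 + b * v 0)) + (\<Sum>b\<in>{0..<s}. - w * \<phi> 0 (b * v 0)))))
          = \<phi> 0 0 + w * (s * (\<phi> (v 0) (v 1) - \<phi> 0 0))"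
        unfolding radon_inversion[OF s \<phi>]
        by (simp add: sum.cartesian_product sum_subtractf sum_distrib_left sum_negf algebra_simps case_prod_unfold)
      also have "[\<dots> = \<phi> (v 0) (v 1)] (mod r)"
        using cong_add[OF cong_refl[of "\<phi> 0 0"] cong_mult[OF w cong_refl[of "\<phi> (v 0) (v 1) - \<phi> 0 0"]]]
        by (simp add: mult_ac)
      finally have "[\<phi> (v 0) (v 1) = sum_list (map G \<Sigma>)] (mod r)" by (rule cong_sym)
      moreover have "\<phi> (v 0) (v 1) = \<Psi> (eval_lterm int_loop v t) (eval_lterm int_loop v u)"
        using eval_vec[OF tu(1), of v] eval_vec[OF tu(2), of v] by (simp add: \<phi>_def)
      ultimately show "[\<Psi> (eval_lterm int_loop v t) (eval_lterm int_loop v u) =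
        sum_list (map (\<lambda>\<sigma>. \<Psi> (eval_lterm int_loop (\<lambda>i. eval_lterm int_loop v (\<sigma> i)) t)
                          (eval_lterm int_loop (\<lambda>i. eval_lterm int_loop v (\<sigma> i)) u)) \<Sigma>)] (mod r)"
        by (simp only: G_def[abs_def])
    qed
  qed
qed

section \<open>Defects in a central extension\<close>

lemma int_collapsesD:
  "int_collapses r s m \<Sigma> \<Longrightarrow> biperiodic s \<Psi> \<Longrightarrow> set_lterm t \<subseteq> {..<m} \<Longrightarrow> set_lterm u \<subseteq> {..<m} \<Longrightarrow>
     [\<Psi> (eval_lterm int_loop v t) (eval_lterm int_loop v u) =
      sum_list (map (\<lambda>\<sigma>. \<Psi> (eval_lterm int_loop (\<lambda>i. eval_lterm int_loop v (\<sigma> i)) t)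
                          (eval_lterm int_loop (\<lambda>i. eval_lterm int_loop v (\<sigma> i)) u)) \<Sigma>)] (mod r)"
  by (simp add: int_collapses_def)

context loop
begin

text \<open>Central factors of \<open>b\<^sub>1\<close> and \<open>b\<^sub>2\<close> contribute the same factor to the numerator and to the denominator.\<close>

lemma defect_central_shift:
  assumes a: "a\<^sub>1 \<in> carrier L" "a\<^sub>2 \<in> carrier L" and b: "b\<^sub>1 \<in> carrier L" "b\<^sub>2 \<in> carrier L"
    and z: "z\<^sub>1 \<in> loop_center L" "z\<^sub>2 \<in> loop_center L"
  shows "defect L f a\<^sub>1 a\<^sub>2 (b\<^sub>1 \<otimes> z\<^sub>1) (b\<^sub>2 \<otimes> z\<^sub>2) = defect L f a\<^sub>1 a\<^sub>2 b\<^sub>1 b\<^sub>2"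
proof -
  let ?w = "apply_op L f z\<^sub>1 z\<^sub>2" and ?d = "defect L f a\<^sub>1 a\<^sub>2 b\<^sub>1 b\<^sub>2"
  let ?n = "apply_op L f (a\<^sub>1 \<otimes> b\<^sub>1) (a\<^sub>2 \<otimes> b\<^sub>2)" and ?e = "apply_op L f a\<^sub>1 a\<^sub>2 \<otimes> apply_op L f b\<^sub>1 b\<^sub>2"
  have w: "?w \<in> loop_center L" using z by (rule center_op)
  have e: "?e \<in> carrier L" using a b by (simp add: op_closed m_closed)
  have d: "?d \<in> carrier L" using a b by (rule defect_closed)
  have "apply_op L f (a\<^sub>1 \<otimes> (b\<^sub>1 \<otimes> z\<^sub>1)) (a\<^sub>2 \<otimes> (b\<^sub>2 \<otimes> z\<^sub>2)) = ?n \<otimes> ?w"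
    using a b z by (simp add: center_assoc3 op_center_interchange m_closed)
  also have "?n = ?d \<otimes> ?e" using a b by (simp add: defect_mult)
  also have "(?d \<otimes> ?e) \<otimes> ?w = ?d \<otimes> (?e \<otimes> ?w)" using center_assoc3[OF w d e] by simp
  also have "?e \<otimes> ?w = apply_op L f a\<^sub>1 a\<^sub>2 \<otimes> apply_op L f (b\<^sub>1 \<otimes> z\<^sub>1) (b\<^sub>2 \<otimes> z\<^sub>2)"
    using center_assoc3[OF w, of "apply_op L f a\<^sub>1 a\<^sub>2" "apply_op L f b\<^sub>1 b\<^sub>2"] a b z
    by (simp add: op_center_interchange op_closed)
  finally show ?thesis
    unfolding defect_def[of L f a\<^sub>1 a\<^sub>2 "b\<^sub>1 \<otimes> z\<^sub>1" "b\<^sub>2 \<otimes> z\<^sub>2"]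
    using d a b z by (intro rdiv_eqI) (simp_all add: m_closed op_closed center_closed)
qed

lemma abelian_defect:
  assumes Z: "loop_center L = carrier L" and ab: "a\<^sub>1 \<in> carrier L" "a\<^sub>2 \<in> carrier L" "b\<^sub>1 \<in> carrier L" "b\<^sub>2 \<in> carrier L"
  shows "defect L f a\<^sub>1 a\<^sub>2 b\<^sub>1 b\<^sub>2 = \<one>"
  unfolding defect_def using ab Z
  by (intro rdiv_eqI) (auto simp: op_center_interchange op_closed m_closed l_one one_closed)

text \<open>The map \<open>\<beta>\<close> sends a defect to a defect of an abelian group, which is trivial; hence defects are central. A
  defect depends on \<open>b\<^sub>1\<close> and \<open>b\<^sub>2\<close> only through their images under \<open>\<beta>\<close>, so \<open>\<gamma>\<close> of it is a function
  \<open>\<Psi>\<close> of two residues. When \<open>b\<^sub>1\<close> and \<open>b\<^sub>2\<close> are values of terms, these residues are values of the same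
  terms in the integers, and the collapse of \<open>\<Psi>\<close> applies.\<close>

lemma central_extension_defects:
  fixes \<beta> \<gamma> :: "'a \<Rightarrow> int" and r s :: int
  assumes \<beta>_hom: "\<And>x y. x \<in> carrier L \<Longrightarrow> y \<in> carrier L \<Longrightarrow> [\<beta> (x \<otimes> y) = \<beta> x + \<beta> y] (mod s)"
    and \<beta>_ker: "\<And>x y. x \<in> carrier L \<Longrightarrow> y \<in> carrier L \<Longrightarrow> [\<beta> x = \<beta> y] (mod s) \<Longrightarrow> \<exists>z\<in>loop_center L. y = x \<otimes> z"
    and \<gamma>_hom: "\<And>x y. x \<in> loop_center L \<Longrightarrow> y \<in> loop_center L \<Longrightarrow> [\<gamma> (x \<otimes> y) = \<gamma> x + \<gamma> y] (mod r)"
    and \<gamma>_inj: "\<And>x y. x \<in> loop_center L \<Longrightarrow> y \<in> loop_center L \<Longrightarrow> [\<gamma> x = \<gamma> y] (mod r) \<Longrightarrow> x = y"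
    and \<Sigma>: "int_collapses r s m \<Sigma>"
  shows "central_defects L" "defect_collapses L m \<Sigma>"
proof -
  have \<beta>_op: "[\<beta> (apply_op L f x y) = apply_op int_loop f (\<beta> x) (\<beta> y)] (mod s)" if xy: "x \<in> carrier L" "y \<in> carrier L" for f x y
  proof (cases f)
    case Times
    then show ?thesis using \<beta>_hom[OF xy] by simp
  next
    case Under
    have "[\<beta> y = \<beta> x + \<beta> (ldiv L x y)] (mod s)"
      using \<beta>_hom[of x "ldiv L x y"] xy by (simp add: ldiv_closed mult_ldiv)
    then show ?thesis using Under by (simp add: cong_iff_dvd_diff dvd_diff_commute algebra_simps)
  next
    case Over
    have "[\<beta> x = \<beta> (rdiv L x y) + \<beta> y] (mod s)"
      using \<beta>_hom[of "rdiv L x y" y] xy by (simp add: rdiv_closed mult_rdiv)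
    then show ?thesis using Over by (simp add: cong_iff_dvd_diff dvd_diff_commute algebra_simps)
  qed
  have \<beta>_one: "[\<beta> \<one> = 0] (mod s)"
    using \<beta>_hom[of \<one> \<one>] by (simp add: l_one one_closed cong_iff_dvd_diff)
  have \<beta>_eval: "[\<beta> (eval_lterm L e t) = eval_lterm int_loop (\<lambda>i. \<beta> (e i)) t] (mod s)"
    if e: "\<And>i. e i \<in> carrier L" for e and t :: "nat lterm"
  proof (induction t rule: lterm_op_induct)
    case (Op f t u)
    have "[\<beta> (apply_op L f (eval_lterm L e t) (eval_lterm L e u)) =
        apply_op int_loop f (\<beta> (eval_lterm L e t)) (\<beta> (eval_lterm L e u))] (mod s)"
      by (intro \<beta>_op eval_closed e)
    also have "[apply_op int_loop f (\<beta> (eval_lterm L e t)) (\<beta> (eval_lterm L e u)) =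
        apply_op int_loop f (eval_lterm int_loop (\<lambda>i. \<beta> (e i)) t) (eval_lterm int_loop (\<lambda>i. \<beta> (e i)) u)] (mod s)"
      by (intro int_loop_op_cong Op)
    finally show ?case by simp
  qed (simp_all add: \<beta>_one)
  have central: "defect L f a\<^sub>1 a\<^sub>2 b\<^sub>1 b\<^sub>2 \<in> loop_center L"
    if ab: "a\<^sub>1 \<in> carrier L" "a\<^sub>2 \<in> carrier L" "b\<^sub>1 \<in> carrier L" "b\<^sub>2 \<in> carrier L" for f a\<^sub>1 a\<^sub>2 b\<^sub>1 b\<^sub>2
  proof -
    let ?n = "apply_op L f (a\<^sub>1 \<otimes> b\<^sub>1) (a\<^sub>2 \<otimes> b\<^sub>2)" and ?e = "apply_op L f a\<^sub>1 a\<^sub>2 \<otimes> apply_op L f b\<^sub>1 b\<^sub>2"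
    have cl: "?n \<in> carrier L" "?e \<in> carrier L" using ab by (auto intro!: op_closed m_closed)
    have "[\<beta> ?e = \<beta> (apply_op L f a\<^sub>1 a\<^sub>2) + \<beta> (apply_op L f b\<^sub>1 b\<^sub>2)] (mod s)"
      using ab by (intro \<beta>_hom op_closed)
    also have "[\<beta> (apply_op L f a\<^sub>1 a\<^sub>2) + \<beta> (apply_op L f b\<^sub>1 b\<^sub>2) =
        apply_op int_loop f (\<beta> a\<^sub>1) (\<beta> a\<^sub>2) + apply_op int_loop f (\<beta> b\<^sub>1) (\<beta> b\<^sub>2)] (mod s)"
      using ab by (intro cong_add \<beta>_op)
    also have "apply_op int_loop f (\<beta> a\<^sub>1) (\<beta> a\<^sub>2) + apply_op int_loop f (\<beta> b\<^sub>1) (\<beta> b\<^sub>2) =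
        apply_op int_loop f (\<beta> a\<^sub>1 + \<beta> b\<^sub>1) (\<beta> a\<^sub>2 + \<beta> b\<^sub>2)"
      by (rule int_loop_op_add[symmetric])
    also have "[apply_op int_loop f (\<beta> a\<^sub>1 + \<beta> b\<^sub>1) (\<beta> a\<^sub>2 + \<beta> b\<^sub>2) =
        apply_op int_loop f (\<beta> (a\<^sub>1 \<otimes> b\<^sub>1)) (\<beta> (a\<^sub>2 \<otimes> b\<^sub>2))] (mod s)"
      using ab by (intro int_loop_op_cong cong_sym[OF \<beta>_hom])
    also have "[apply_op int_loop f (\<beta> (a\<^sub>1 \<otimes> b\<^sub>1)) (\<beta> (a\<^sub>2 \<otimes> b\<^sub>2)) = \<beta> ?n] (mod s)"
      using ab by (intro cong_sym[OF \<beta>_op] m_closed)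
    finally obtain z where z: "z \<in> loop_center L" "?n = ?e \<otimes> z" using \<beta>_ker cl by blast
    have "z \<otimes> ?e = ?n" using center_comm[OF z(1) cl(2)] z(2) by (rule HOL.trans[OF _ HOL.sym])
    then have "rdiv L ?n ?e = z" using cl(2) center_closed[OF z(1)] by (rule rdiv_eqI)
    then show ?thesis using z by (simp add: defect_def)
  qed
  then show "central_defects L" by (simp add: central_defects_def)
  have \<gamma>_one: "[\<gamma> \<one> = 0] (mod r)"
    using \<gamma>_hom[of \<one> \<one>] by (simp add: one_center l_one one_closed cong_iff_dvd_diff)
  have \<gamma>_product: "[\<gamma> (loop_product L (map z xs)) = sum_list (map (\<lambda>x. \<gamma> (z x)) xs)] (mod r)"
    if "\<And>x. z x \<in> loop_center L" for z :: "'c \<Rightarrow> 'a" and xs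
  proof (induction xs)
    case (Cons x xs)
    have "[\<gamma> (z x \<otimes> loop_product L (map z xs)) = \<gamma> (z x) + \<gamma> (loop_product L (map z xs))] (mod r)"
      using that by (intro \<gamma>_hom product_center) auto
    also have "[\<gamma> (z x) + \<gamma> (loop_product L (map z xs)) = \<gamma> (z x) + sum_list (map (\<lambda>x. \<gamma> (z x)) xs)] (mod r)"
      by (intro cong_add cong_refl Cons)
    finally show ?case by simp
  qed (simp add: \<gamma>_one)
  show "defect_collapses L m \<Sigma>"
    unfolding defect_collapses_def
  proof (intro allI impI)
    fix f s' t a\<^sub>1 a\<^sub>2 and y :: "nat \<Rightarrow> 'a"
    assume st: "set_lterm s' \<subseteq> {..<m}" "set_lterm t \<subseteq> {..<m}"
      and a: "a\<^sub>1 \<in> carrier L" "a\<^sub>2 \<in> carrier L" and "\<forall>i. y i \<in> carrier L"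
    then have y: "y i \<in> carrier L" for i by blast
    define d where "d = defect L f a\<^sub>1 a\<^sub>2"
    have d_center: "d b\<^sub>1 b\<^sub>2 \<in> loop_center L" if "b\<^sub>1 \<in> carrier L" "b\<^sub>2 \<in> carrier L" for b\<^sub>1 b\<^sub>2
      unfolding d_def using a that by (rule central)
    \<comment> \<open>\<open>\<Psi>\<close> is defined through representatives; a residue without preimage under \<open>\<beta>\<close> is represented by \<open>\<one>\<close>.\<close>
    define C where "C i = {b \<in> carrier L. [\<beta> b = i] (mod s)}" for i
    define rep where "rep i = (if C i = {} then \<one> else SOME b. b \<in> C i)" for i
    have C_cong: "C i = C j" if "[i = j] (mod s)" for i j
      using that cong_trans cong_sym unfolding C_def by blast
    have rep: "rep (\<beta> b) \<in> carrier L \<and> [\<beta> (rep (\<beta> b)) = \<beta> b] (mod s)" if "b \<in> carrier L" for b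
    proof -
      have "b \<in> C (\<beta> b)" using that by (simp add: C_def)
      then have "rep (\<beta> b) \<in> C (\<beta> b)" unfolding rep_def using someI[of "\<lambda>x. x \<in> C (\<beta> b)" b] by auto
      then show ?thesis by (simp add: C_def)
    qed
    define \<Psi> where "\<Psi> i j = \<gamma> (d (rep i) (rep j))" for i j
    have \<Psi>: "biperiodic s \<Psi>"
      using C_cong unfolding biperiodic_def \<Psi>_def rep_def by metis
    have d\<Psi>: "\<gamma> (d b\<^sub>1 b\<^sub>2) = \<Psi> i j"
      if b: "b\<^sub>1 \<in> carrier L" "b\<^sub>2 \<in> carrier L" and ij: "[\<beta> b\<^sub>1 = i] (mod s)" "[\<beta> b\<^sub>2 = j] (mod s)" for b\<^sub>1 b\<^sub>2 i j
    proof -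
      obtain z\<^sub>1 where z1: "z\<^sub>1 \<in> loop_center L" "b\<^sub>1 = rep (\<beta> b\<^sub>1) \<otimes> z\<^sub>1" using rep[OF b(1)] \<beta>_ker b(1) by blast
      obtain z\<^sub>2 where z2: "z\<^sub>2 \<in> loop_center L" "b\<^sub>2 = rep (\<beta> b\<^sub>2) \<otimes> z\<^sub>2" using rep[OF b(2)] \<beta>_ker b(2) by blast
      have "d b\<^sub>1 b\<^sub>2 = d (rep (\<beta> b\<^sub>1) \<otimes> z\<^sub>1) (rep (\<beta> b\<^sub>2) \<otimes> z\<^sub>2)" using z1(2) z2(2) by metis
      also have "\<dots> = d (rep (\<beta> b\<^sub>1)) (rep (\<beta> b\<^sub>2))"
        unfolding d_def using rep b z1(1) z2(1) a by (intro defect_central_shift) auto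
      finally have "\<gamma> (d b\<^sub>1 b\<^sub>2) = \<Psi> (\<beta> b\<^sub>1) (\<beta> b\<^sub>2)" by (simp add: \<Psi>_def)
      also have "\<dots> = \<Psi> i j" using ij by (rule biperiodicD[OF \<Psi>])
      finally show ?thesis .
    qed
    define y\<sigma> where "y\<sigma> \<sigma> i = eval_lterm L y (\<sigma> i)" for \<sigma> :: "nat \<Rightarrow> nat lterm" and i
    have y\<sigma>: "y\<sigma> \<sigma> i \<in> carrier L" for \<sigma> i unfolding y\<sigma>_def by (intro eval_closed y)
    let ?\<beta>y = "\<lambda>i. \<beta> (y i)"
    have \<beta>_subst: "[\<beta> (eval_lterm L (y\<sigma> \<sigma>) u) = eval_lterm int_loop (\<lambda>i. eval_lterm int_loop ?\<beta>y (\<sigma> i)) u] (mod s)" for \<sigma> u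
    proof -
      have "[\<beta> (eval_lterm L (y\<sigma> \<sigma>) u) = eval_lterm int_loop (\<lambda>i. \<beta> (y\<sigma> \<sigma> i)) u] (mod s)" by (intro \<beta>_eval y\<sigma>)
      also have "[eval_lterm int_loop (\<lambda>i. \<beta> (y\<sigma> \<sigma> i)) u = eval_lterm int_loop (\<lambda>i. eval_lterm int_loop ?\<beta>y (\<sigma> i)) u] (mod s)"
        unfolding y\<sigma>_def by (intro eval_int_cong \<beta>_eval y)
      finally show ?thesis .
    qed
    let ?D = "\<lambda>\<sigma>. d (eval_lterm L (y\<sigma> \<sigma>) s') (eval_lterm L (y\<sigma> \<sigma>) t)"
    have D: "?D \<sigma> \<in> loop_center L" for \<sigma> by (intro d_center eval_closed y\<sigma>)
    have "\<gamma> (d (eval_lterm L y s') (eval_lterm L y t)) = \<Psi> (eval_lterm int_loop ?\<beta>y s') (eval_lterm int_loop ?\<beta>y t)"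
      by (intro d\<Psi> eval_closed \<beta>_eval y)
    also have "[\<Psi> (eval_lterm int_loop ?\<beta>y s') (eval_lterm int_loop ?\<beta>y t) =
        sum_list (map (\<lambda>\<sigma>. \<Psi> (eval_lterm int_loop (\<lambda>i. eval_lterm int_loop ?\<beta>y (\<sigma> i)) s')
                          (eval_lterm int_loop (\<lambda>i. eval_lterm int_loop ?\<beta>y (\<sigma> i)) t)) \<Sigma>)] (mod r)"
      by (rule int_collapsesD[OF \<Sigma> \<Psi> st])
    also have "map (\<lambda>\<sigma>. \<Psi> (eval_lterm int_loop (\<lambda>i. eval_lterm int_loop ?\<beta>y (\<sigma> i)) s')
                          (eval_lterm int_loop (\<lambda>i. eval_lterm int_loop ?\<beta>y (\<sigma> i)) t)) \<Sigma> = map (\<lambda>\<sigma>. \<gamma> (?D \<sigma>)) \<Sigma>"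
      by (intro map_cong HOL.refl d\<Psi>[symmetric] eval_closed y\<sigma> \<beta>_subst)
    also have "[sum_list (map (\<lambda>\<sigma>. \<gamma> (?D \<sigma>)) \<Sigma>) = \<gamma> (loop_product L (map ?D \<Sigma>))] (mod r)"
      by (rule cong_sym[OF \<gamma>_product[OF D]])
    finally have "d (eval_lterm L y s') (eval_lterm L y t) = loop_product L (map ?D \<Sigma>)"
      using D by (intro \<gamma>_inj d_center eval_closed y product_center) auto
    then show "defect L f a\<^sub>1 a\<^sub>2 (eval_lterm L y s') (eval_lterm L y t) =
      loop_product L (map (\<lambda>\<sigma>. defect L f a\<^sub>1 a\<^sub>2 (eval_lterm L (\<lambda>i. eval_lterm L y (\<sigma> i)) s')
                                             (eval_lterm L (\<lambda>i. eval_lterm L y (\<sigma> i)) t)) \<Sigma>)"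
      by (simp add: d_def y\<sigma>_def[abs_def])
  qed
qed

lemma order_pq_collapses:
  assumes "prime (p::nat)" "prime q" "nilpotent_loop L" "order L = p * q"
  obtains m \<Sigma> where "0 < m" "\<And>\<sigma>. \<sigma> \<in> set \<Sigma> \<Longrightarrow> degenerate_subst m \<sigma>" "central_defects L" "defect_collapses L m \<Sigma>"
  using assms
proof (cases rule: nilpotent_order_pq_structure)
  case abelian
  have "central_defects L"
    using abelian_defect[OF abelian] one_center by (simp add: central_defects_def)
  moreover have "defect_collapses L 1 []"
    unfolding defect_collapses_def by (auto intro!: abelian_defect[OF abelian] eval_closed)
  ultimately show ?thesis using that[of 1 "[]"] by simp
next
  case (central_extension r s \<beta> \<gamma>)
  note * = central_extension_defects[of \<beta> "int s" \<gamma> "int r", OF central_extension(3-6)]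
  show ?thesis
  proof (cases "r = s")
    case True
    obtain \<Sigma> where \<Sigma>: "\<And>\<sigma>. \<sigma> \<in> set \<Sigma> \<Longrightarrow> degenerate_subst (s ^ 3) \<sigma>" "int_collapses (int s) (int s) (s ^ 3) \<Sigma>"
      using int_collapses_equal_primes[OF central_extension(2)] by blast
    show ?thesis
      using that[OF _ \<Sigma>(1) *(1) *(2)] \<Sigma>(2) True prime_gt_0_nat[OF central_extension(2)] by auto
  next
    case False
    obtain \<Sigma> where \<Sigma>: "\<And>\<sigma>. \<sigma> \<in> set \<Sigma> \<Longrightarrow> degenerate_subst 2 \<sigma>" "int_collapses (int r) (int s) 2 \<Sigma>"
      using int_collapses_distinct_primes[of "int r" "int s"] central_extension(1,2) False by auto
    show ?thesis using that[OF _ \<Sigma>(1) *(1) *(2)] \<Sigma>(2) by auto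
  qed
qed

end

section \<open>The finite basis\<close>

theorem theorem3p2:
  fixes L :: "('a, 'm) loop_scheme" and p q :: nat
  assumes "prime p" and "prime q"
    and "loop L" and "nilpotent_loop L" and "order L = p * q"
  shows "has_finite_equational_basis L"
proof -
  interpret loop L by fact
  obtain m \<Sigma> where m: "0 < m" and \<Sigma>: "\<And>\<sigma>. \<sigma> \<in> set \<Sigma> \<Longrightarrow> degenerate_subst m \<sigma>"
      and cd: "central_defects L" and dc: "defect_collapses L m \<Sigma>"
    using order_pq_collapses[OF assms(1,2,4,5)] by blast
  have "0 < order L" using assms prime_gt_0_nat by simp
  then have fin: "finite (carrier L)" by (simp add: order_def card_ge_0_finite)
  obtain B where B: "finite B" "\<And>\<epsilon>. \<epsilon> \<in> B \<Longrightarrow> holds_in L \<epsilon>"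
    and derivable: "\<And>s t. set_lterm s \<subseteq> {..<m + 6} \<Longrightarrow> set_lterm t \<subseteq> {..<m + 6} \<Longrightarrow> holds_in L (s, t) \<Longrightarrow> eq_derivable B s t"
    using finitely_many_variables_basis[OF assms(3) fin, of "m + 6"] by blast
  let ?M = "loop_quotient term_algebra (derivability B)"
  have sub: "holds_in ?M (s, t)" if "set_lterm s \<subseteq> {..<m + 6}" "set_lterm t \<subseteq> {..<m + 6}" "holds_in L (s, t)" for s t
    using derivable[OF that] by (simp add: holds_in_free_algebra_iff)
  have M: "loop ?M"
  proof (rule quotient_loop[OF derivability_congruence])
    fix \<epsilon> assume \<epsilon>: "\<epsilon> \<in> loop_laws"
    obtain s t where st: "\<epsilon> = (s, t)" by (cases \<epsilon>)
    have "set_lterm s \<subseteq> {..<m + 6}" "set_lterm t \<subseteq> {..<m + 6}"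
      using \<epsilon> m by (auto simp: st loop_laws_def)
    then show "holds_in ?M \<epsilon>" using sub laws_hold[OF \<epsilon>] st by simp
  qed simp
  have "eq_derivable B s t" if "holds_in L (s, t)" for s t
    using identities_bounded_variables[OF assms(3) cd dc \<Sigma> m M sub that]
    by (simp add: holds_in_free_algebra_iff)
  then show ?thesis unfolding has_finite_equational_basis_def using B by blast
qed

end
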